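(* Let $G$ be a torus with Lie algebra $\mathfrak g$ and integral lattice $\mathbb Z_G\subset\mathfrak g$. Let $u_1,\dots,u_N\in\mathbb Z_G$ be primitive vectors spanning $\mathfrak g$ over $\mathbb R$, let $\lambda_1,\dots,\lambda_N\in\mathbb R$, and let $P=\{\eta\in\mathfrak g^*\mid \langle\eta,u_j\rangle-\lambda_j\ge 0,\ 1\le j\le N\}$. Assume that $P$ has non-empty interior and that the collection of inequalities defining $P$ is minimal (dropping any one of them gives a strictly bigger set). Let $F\subset P$ be a face whose interior is $$\mathring F=\bigcap_{j\notin I}\{\eta\mid\langle\eta,u_j\rangle-\lambda_j>0\}\cap\bigcap_{j\in I}\{\eta\mid\langle\eta,u_j\rangle-\lambda_j=0\}$$ for a nonempty subset $I\subset\{1,\dots,N\}$, and let $\eta_0\in\mathring F$. Let $\phi_P:M_P\to\mathfrak g^*$ be the Kähler quotient of $\mathbb C^N$ and its moment map described in the context, and $M_{\mathring F}:=\phi_P^{-1}(\mathring F)$. Let $\mathfrak g_I^*=\{\eta\in\mathfrak g^*\mid\langle\eta,u_i\rangle=0\text{ for all }i\in I\}$, so that the affine span of $\mathring F$ is $\eta_0+\mathfrak g_I^*$. Identify this affine span with $\mathfrak g_I^*$ via the affine isomorphism $\gamma_I:\mathfrak g_I^*\to\eta_0+\mathfrak g_I^*$, $\gamma_I(\xi)=\xi+\eta_0$, so that $\phi_P|_{M_{\mathring F}}$ is regarded as the $\mathfrak g_I^*$-valued map $\gamma_I^{-1}\circ\phi_P|_{M_{\mathring F}}$. Then the Kähler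 form $\omega_F$ on $M_{\mathring F}$ is $$\omega_F=\sqrt{-1}\,\partial\bar\partial\Big((\phi_P|_{M_{\mathring F}})^*\sum_{j\notin I}\Big((\lambda_j-u_j(\eta_0))\log\big(u_j|_{\mathfrak g_I^*}+u_j(\eta_0)-\lambda_j\big)+u_j|_{\mathfrak g_I^*}\Big)\Big),$$ where $u_j$ is regarded as the linear function $\eta\mapsto\langle\eta,u_j\rangle$ on $\mathfrak g^*$.
   Context: Construction of $M_P$. Let $A:\mathbb R^N\to\mathfrak g$ be the linear map with $A(e_i)=u_i$ ($e_i$ the standard basis, $e_i^*$ the dual basis of $(\mathbb R^N)^*$). It maps $\mathbb Z^N$ into $\mathbb Z_G$ and induces a surjective homomorphism $\bar A:\mathbb T^N=\mathbb R^N/\mathbb Z^N\to\mathfrak g/\mathbb Z_G=G$. Let $K=\ker\bar A$, a compact abelian (possibly disconnected) group with Lie algebra $\mathfrak k=\ker A$, let $B:\mathfrak k\to\mathbb R^N$ be the inclusion, and let $A^*,B^*$ be the dual maps. Put $\lambda=\sum_i\lambda_ie_i^*$, $\nu=B^*(-\lambda)\in\mathfrak k^*$, and let $\iota_\lambda:\mathfrak g^*\to(\mathbb R^N)^*$, $\iota_\lambda(\ell)=-\lambda+A^*(\ell)$, an affine embedding with image $(B^* )^{-1}(\nu)$. Equip $\mathbb C^N$ with the flat Kähler form $\sqrt{-1}\sum_j dz_j\wedge d\bar z_j=\sqrt{-1}\,\partial\bar\partial\|z\|^2$ and the standard $\mathbb T^N$-action, with moment map normalized as $\phi(z)=\sum_j|z_j|^2e_j^*$.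 The $K$-moment map is $\phi_K=B^*\circ\phi$. Set $M_P:=\phi_K^{-1}(\nu)/K$, on which $G=\mathbb T^N/K$ acts. One has $\phi(\phi_K^{-1}(\nu))=\iota_\lambda(P)$. The restriction of $\phi$ to $\phi_K^{-1}(\nu)$ descends to $\bar\phi:M_P\to\iota_\lambda(\mathfrak g^* )$, and $\phi_P:=\iota_\lambda^{-1}\circ\bar\phi:M_P\to\mathfrak g^*$ is the moment map, with image $P$. Kähler structure on $M_{\mathring F}$. Let $\mathring V_I=\{z\in\mathbb C^N\mid z_j=0\Leftrightarrow j\in I\}$, a Kähler submanifold of $\mathbb C^N$, and $\mathbb T^N_I=\{a\in\mathbb T^N\mid a_j=1\text{ for }j\notin I\}$. The group $K_I=K/(K\cap\mathbb T^N_I)$ acts freely on $\mathring V_I$, and $M_{\mathring F}=\phi_P^{-1}(\mathring F)=(\phi_K^{-1}(\nu)\cap\mathring V_I)/K$ is the regular Kähler quotient of $\mathring V_I$ (with the form induced from $\mathbb C^N$) by $K_I$. It carries the usual reduced complex structure and reduced Kähler form $\omega_F$ (its pullback to $\phi_K^{-1}(\nu)\cap\mathring V_I$ is the restriction of the flat Kähler form). *)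

theory Defs
  imports "HOL-Analysis.Analysis"
begin

section \<open>Tori, polyhedra and dual spaces\<close>

text \<open>
  A torus \<open>G\<close> is given by its Lie algebra, a type \<open>'g\<close>, and its integral lattice \<open>ZG\<close>, so that
  \<open>G = 'g / ZG\<close>. The inner product of \<open>'g\<close> plays no role: the dual space is \<open>'g \<Rightarrow>\<^sub>L real\<close>.
\<close>

definition full_lattice :: "'g::euclidean_space set \<Rightarrow> bool" where
  "full_lattice L \<longleftrightarrow>
     (\<exists>B. independent B \<and> span B = UNIV \<and> L = range (\<lambda>c. \<Sum>b\<in>B. of_int (c b) *\<^sub>R b))"

definition primitive_in :: "'g::real_vector set \<Rightarrow> 'g \<Rightarrow> bool" where
  "primitive_in L v \<longleftrightarrow> v \<in> L \<and> (\<forall>k::int. \<forall>w\<in>L. v = of_int k *\<^sub>R w \<longrightarrow> \<bar>k\<bar> = 1)"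

definition polyhedron_of :: "('n \<Rightarrow> 'g::real_normed_vector) \<Rightarrow> ('n \<Rightarrow> real) \<Rightarrow> ('g \<Rightarrow>\<^sub>L real) set" where
  "polyhedron_of u lam = {\<eta> :: 'g \<Rightarrow>\<^sub>L real. \<forall>j. \<eta> (u j) - lam j \<ge> 0}"

definition open_face ::
  "('n \<Rightarrow> 'g::real_normed_vector) \<Rightarrow> ('n \<Rightarrow> real) \<Rightarrow> 'n set \<Rightarrow> ('g \<Rightarrow>\<^sub>L real) set" where
  "open_face u lam I =
     (\<Inter>j\<in>-I. {\<eta> :: 'g \<Rightarrow>\<^sub>L real. \<eta> (u j) - lam j > 0}) \<inter> (\<Inter>j\<in>I. {\<eta> :: 'g \<Rightarrow>\<^sub>L real. \<eta> (u j) - lam j = 0})"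

definition annihilator :: "('n \<Rightarrow> 'g::real_normed_vector) \<Rightarrow> 'n set \<Rightarrow> ('g \<Rightarrow>\<^sub>L real) set" where
  "annihilator u I = {\<eta> :: 'g \<Rightarrow>\<^sub>L real. \<forall>i\<in>I. \<eta> (u i) = 0}"

definition gamma_map :: "('g::real_normed_vector \<Rightarrow>\<^sub>L real) \<Rightarrow> ('g \<Rightarrow>\<^sub>L real) \<Rightarrow> ('g \<Rightarrow>\<^sub>L real)" where
  "gamma_map \<eta>0 \<xi> = \<xi> + \<eta>0"

definition dual_basis :: "'n::finite \<Rightarrow> ((real^'n) \<Rightarrow>\<^sub>L real)" where
  "dual_basis j = Blinfun (\<lambda>t. t $ j)"

definition A_map :: "('n::finite \<Rightarrow> 'g::real_normed_vector) \<Rightarrow> ((real^'n) \<Rightarrow>\<^sub>L 'g)" where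
  "A_map u = Blinfun (\<lambda>t. \<Sum>j\<in>UNIV. t $ j *\<^sub>R u j)"

definition A_dual ::
  "('n::finite \<Rightarrow> 'g::real_normed_vector) \<Rightarrow> ('g \<Rightarrow>\<^sub>L real) \<Rightarrow> ((real^'n) \<Rightarrow>\<^sub>L real)" where
  "A_dual u l = l o\<^sub>L A_map u"

definition k_alg :: "('n::finite \<Rightarrow> 'g::real_normed_vector) \<Rightarrow> (real^'n) set" where
  "k_alg u = {t. A_map u t = 0}"

text \<open>
  The dual of the subspace \<open>k_alg u\<close> is modelled by functions that are \<open>undefined\<close> off \<open>k_alg u\<close>;
  the dual of the inclusion \<open>B\<close> is then the restriction of functionals.
\<close>

definition B_dual ::
  "('n::finite \<Rightarrow> 'g::real_normed_vector) \<Rightarrow> ((real^'n) \<Rightarrow>\<^sub>L real) \<Rightarrow> (real^'n \<Rightarrow> real)" where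
  "B_dual u \<psi> = restrict (blinfun_apply \<psi>) (k_alg u)"

definition lam_vec :: "('n::finite \<Rightarrow> real) \<Rightarrow> ((real^'n) \<Rightarrow>\<^sub>L real)" where
  "lam_vec lam = (\<Sum>j\<in>UNIV. lam j *\<^sub>R dual_basis j)"

definition iota ::
  "('n::finite \<Rightarrow> 'g::real_normed_vector) \<Rightarrow> ('n \<Rightarrow> real) \<Rightarrow> ('g \<Rightarrow>\<^sub>L real) \<Rightarrow> ((real^'n) \<Rightarrow>\<^sub>L real)" where
  "iota u lam l = - lam_vec lam + A_dual u l"

text \<open>
  The torus \<open>\<real>^N / \<int>^N\<close> is realised as the vectors with all entries of modulus one, via
  \<open>[t] \<mapsto> (exp(2 \<pi> i t\<^sub>j))\<^sub>j\<close>. Multiplication on \<open>complex^'n\<close> is componentwise, hence \<open>a * z\<close> is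
  both the product of the torus and its standard action. The kernel of the induced homomorphism
  \<open>[t] \<mapsto> A t + ZG\<close> to \<open>'g / ZG\<close> consists of the classes of those \<open>t\<close> with \<open>A t \<in> ZG\<close>.
\<close>

definition torus_exp :: "real^'n \<Rightarrow> complex^'n" where
  "torus_exp t = (\<chi> j. exp (2 * of_real pi * \<i> * of_real (t $ j)))"

definition K_group :: "'g::real_normed_vector set \<Rightarrow> ('n::finite \<Rightarrow> 'g) \<Rightarrow> (complex^'n) set" where
  "K_group ZG u = torus_exp ` {t. A_map u t \<in> ZG}"


section \<open>Smooth maps on open subsets of normed spaces\<close>

primrec Ck_on :: "nat \<Rightarrow> 'a::real_normed_vector set \<Rightarrow> ('a \<Rightarrow> 'b::real_normed_vector) \<Rightarrow> bool" where
  "Ck_on 0 U f \<longleftrightarrow> continuous_on U f"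
| "Ck_on (Suc k) U f \<longleftrightarrow> (\<forall>x\<in>U. f differentiable (at x)) \<and>
     (\<forall>v. Ck_on k U (\<lambda>x. frechet_derivative f (at x) v))"

text \<open>A smooth map from a neighbourhood \<open>U\<close> of the origin with values in the set \<open>Z\<close>.\<close>

definition smooth_plot :: "'b::real_normed_vector set \<Rightarrow> 'a::real_normed_vector set \<Rightarrow> ('a \<Rightarrow> 'b) \<Rightarrow> bool"
  where
  "smooth_plot Z U s \<longleftrightarrow> open U \<and> 0 \<in> U \<and> (\<forall>k. Ck_on k U s) \<and> s ` U \<subseteq> Z"

definition tangent_space :: "'b::real_normed_vector set \<Rightarrow> 'b \<Rightarrow> 'b set" where
  "tangent_space Z z = {v. \<exists>U (c::real \<Rightarrow> 'b). smooth_plot Z U c \<and> c 0 = z \<and>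
     (c has_vector_derivative v) (at 0)}"


section \<open>Regular Kaehler quotients of submanifolds of complex coordinate space\<close>

text \<open>The form \<open>i \<Sum>\<^sub>j dz\<^sub>j \<and> d(cnj z\<^sub>j)\<close>; its values are real.\<close>

definition flat_form :: "complex^'n::finite \<Rightarrow> complex^'n \<Rightarrow> complex" where
  "flat_form v w = \<i> * (\<Sum>j\<in>UNIV. v $ j * cnj (w $ j) - w $ j * cnj (v $ j))"

text \<open>
  Below, \<open>Z\<close> is the regular level set, a submanifold of \<open>complex^'n\<close>, and \<open>K\<close> is a closed subgroup
  of the torus, with Lie algebra \<open>k\<close>. The quotient \<open>Z/K\<close> is the set of orbits. The tangent space
  at the orbit of \<open>z\<close> is the quotient of the tangent space of \<open>Z\<close> at \<open>z\<close> by the tangent space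
  \<open>vert k z\<close> of the orbit, up to the action of \<open>K\<close>. Accordingly, the image \<open>dproj K k z v\<close> of the
  tangent vector \<open>v\<close> at \<open>z\<close> under the differential of the projection is the class of all
  \<open>(a * z, a * v + w)\<close>, a set of pairs (base point, vector).
\<close>

type_synonym 'n qpoint = "(complex^'n) set"
type_synonym 'n qtangent = "((complex^'n) \<times> (complex^'n)) set"

definition proj :: "(complex^'n) set \<Rightarrow> complex^'n \<Rightarrow> 'n::finite qpoint" where
  "proj K z = (\<lambda>a. a * z) ` K"

definition vert :: "(real^'n) set \<Rightarrow> complex^'n \<Rightarrow> (complex^'n::finite) set" where
  "vert k z = (\<lambda>\<tau>. \<chi> j. 2 * of_real pi * \<i> * of_real (\<tau> $ j) * z $ j) ` k"

definition dproj ::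
  "(complex^'n) set \<Rightarrow> (real^'n) set \<Rightarrow> complex^'n \<Rightarrow> complex^'n \<Rightarrow> 'n::finite qtangent" where
  "dproj K k z v = {(a * z, a * v + w) | a w. a \<in> K \<and> w \<in> vert k (a * z)}"

definition q_tangent_space ::
  "(complex^'n) set \<Rightarrow> (complex^'n) set \<Rightarrow> (real^'n) set \<Rightarrow> 'n::finite qpoint \<Rightarrow> 'n qtangent set" where
  "q_tangent_space Z K k p = {dproj K k z v | z v. z \<in> Z \<and> proj K z = p \<and> v \<in> tangent_space Z z}"

text \<open>The reduced form: its pullback to \<open>Z\<close> is the restriction of the flat form.\<close>

definition reduced_form ::
  "(complex^'n) set \<Rightarrow> (complex^'n) set \<Rightarrow> (real^'n) set \<Rightarrow> 'n::finite qtangent \<Rightarrow> 'n qtangent \<Rightarrow> complex"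
  where
  "reduced_form Z K k X Y = (THE c. \<exists>z\<in>Z. \<exists>v\<in>tangent_space Z z. \<exists>w\<in>tangent_space Z z.
     X = dproj K k z v \<and> Y = dproj K k z w \<and> c = flat_form v w)"

text \<open>
  The horizontal space is the orthogonal complement, for the flat Riemannian metric (a multiple of
  the real inner product), of the orbit directions inside the tangent space of \<open>Z\<close>. It is a complex
  subspace, and the reduced complex structure is multiplication by \<open>i\<close> on it.
\<close>

definition horizontal :: "(complex^'n) set \<Rightarrow> (real^'n) set \<Rightarrow> complex^'n \<Rightarrow> (complex^'n::finite) set"
  where
  "horizontal Z k z = {v \<in> tangent_space Z z. \<forall>w\<in>vert k z. inner v w = 0}"

definition reduced_J ::
  "(complex^'n) set \<Rightarrow> (complex^'n) set \<Rightarrow> (real^'n) set \<Rightarrow> 'n::finite qtangent \<Rightarrow> 'n qtangent" where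
  "reduced_J Z K k X = (THE Y. \<exists>z\<in>Z. \<exists>v\<in>horizontal Z k z.
     X = dproj K k z v \<and> Y = dproj K k z (\<chi> j. \<i> * v $ j))"

text \<open>
  Smooth maps into \<open>Z/K\<close> are locally of the form \<open>proj K \<circ> s\<close> with \<open>s\<close> a smooth map into \<open>Z\<close>.
  The following is the derivative of \<open>proj K \<circ> s\<close> at \<open>x\<close> in direction \<open>e\<close>.
\<close>

definition pushforward ::
  "(complex^'n) set \<Rightarrow> (real^'n) set \<Rightarrow> ('a::real_normed_vector \<Rightarrow> complex^'n) \<Rightarrow> 'a \<Rightarrow> 'a \<Rightarrow>
   'n::finite qtangent" where
  "pushforward K k s x e = dproj K k (s x) (frechet_derivative s (at x) e)"

definition d_fun ::
  "(complex^'n) set \<Rightarrow> (complex^'n) set \<Rightarrow> (real^'n) set \<Rightarrow> ('n::finite qpoint \<Rightarrow> complex) \<Rightarrow>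
   'n qtangent \<Rightarrow> complex" where
  "d_fun Z K k f X = (THE r. \<exists>U (c::real \<Rightarrow> complex^'n). smooth_plot Z U c \<and>
     X = pushforward K k c 0 1 \<and> ((\<lambda>t. f (proj K (c t))) has_vector_derivative r) (at 0))"

text \<open>
  The exterior derivative of a 1-form \<open>\<theta>\<close> on \<open>Z/K\<close>. It commutes with pullback along smooth maps
  \<open>S\<close> from the plane, so that
  \<open>d\<theta>(\<partial>\<^sub>1S, \<partial>\<^sub>2S) = \<partial>\<^sub>1(\<theta>(\<partial>\<^sub>2S)) - \<partial>\<^sub>2(\<theta>(\<partial>\<^sub>1S))\<close>, and every pair of tangent vectors at a point is of
  the form \<open>(\<partial>\<^sub>1S, \<partial>\<^sub>2S)\<close> at the origin for some \<open>S\<close>.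
\<close>

definition d_form ::
  "(complex^'n) set \<Rightarrow> (complex^'n) set \<Rightarrow> (real^'n) set \<Rightarrow> ('n::finite qtangent \<Rightarrow> complex) \<Rightarrow>
   'n qtangent \<Rightarrow> 'n qtangent \<Rightarrow> complex" where
  "d_form Z K k \<theta> X Y = (THE r. \<exists>U (s::real \<times> real \<Rightarrow> complex^'n) r1 r2. smooth_plot Z U s \<and>
     X = pushforward K k s 0 (1, 0) \<and> Y = pushforward K k s 0 (0, 1) \<and>
     ((\<lambda>x. \<theta> (pushforward K k s (x, 0) (0, 1))) has_vector_derivative r1) (at 0) \<and>
     ((\<lambda>y. \<theta> (pushforward K k s (0, y) (1, 0))) has_vector_derivative r2) (at 0) \<and>
     r = r1 - r2)"

text \<open>The operator dbar on functions is the (0,1)-part of \<open>d\<close>.\<close>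

definition dbar_fun ::
  "(complex^'n) set \<Rightarrow> (complex^'n) set \<Rightarrow> (real^'n) set \<Rightarrow> ('n::finite qpoint \<Rightarrow> complex) \<Rightarrow>
   'n qtangent \<Rightarrow> complex" where
  "dbar_fun Z K k f X = (d_fun Z K k f X + \<i> * d_fun Z K k f (reduced_J Z K k X)) / 2"

text \<open>The operator del on (0,1)-forms is the (1,1)-part of \<open>d\<close>.\<close>

definition del_form ::
  "(complex^'n) set \<Rightarrow> (complex^'n) set \<Rightarrow> (real^'n) set \<Rightarrow> ('n::finite qtangent \<Rightarrow> complex) \<Rightarrow>
   'n qtangent \<Rightarrow> 'n qtangent \<Rightarrow> complex" where
  "del_form Z K k \<theta> X Y =
     (d_form Z K k \<theta> X Y + d_form Z K k \<theta> (reduced_J Z K k X) (reduced_J Z K k Y)) / 2"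


section \<open>The quotient \<open>M_P\<close> and its strata\<close>

definition phi :: "complex^'n \<Rightarrow> ((real^'n::finite) \<Rightarrow>\<^sub>L real)" where
  "phi z = (\<Sum>j\<in>UNIV. (cmod (z $ j))\<^sup>2 *\<^sub>R dual_basis j)"

definition phi_K :: "('n::finite \<Rightarrow> 'g::real_normed_vector) \<Rightarrow> complex^'n \<Rightarrow> (real^'n \<Rightarrow> real)" where
  "phi_K u z = B_dual u (phi z)"

definition nu :: "('n::finite \<Rightarrow> 'g::real_normed_vector) \<Rightarrow> ('n \<Rightarrow> real) \<Rightarrow> (real^'n \<Rightarrow> real)" where
  "nu u lam = B_dual u (- lam_vec lam)"

definition level_set :: "('n::finite \<Rightarrow> 'g::real_normed_vector) \<Rightarrow> ('n \<Rightarrow> real) \<Rightarrow> (complex^'n) set" where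
  "level_set u lam = {z. phi_K u z = nu u lam}"

definition M_P ::
  "'g::real_normed_vector set \<Rightarrow> ('n::finite \<Rightarrow> 'g) \<Rightarrow> ('n \<Rightarrow> real) \<Rightarrow> 'n qpoint set" where
  "M_P ZG u lam = proj (K_group ZG u) ` level_set u lam"

definition phi_bar :: "'n::finite qpoint \<Rightarrow> ((real^'n) \<Rightarrow>\<^sub>L real)" where
  "phi_bar p = the_elem (phi ` p)"

definition phi_P ::
  "('n::finite \<Rightarrow> 'g::real_normed_vector) \<Rightarrow> ('n \<Rightarrow> real) \<Rightarrow> 'n qpoint \<Rightarrow> ('g \<Rightarrow>\<^sub>L real)" where
  "phi_P u lam p = inv (iota u lam) (phi_bar p)"

definition M_face ::
  "'g::real_normed_vector set \<Rightarrow> ('n::finite \<Rightarrow> 'g) \<Rightarrow> ('n \<Rightarrow> real) \<Rightarrow> 'n set \<Rightarrow> 'n qpoint set" where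
  "M_face ZG u lam I = {p \<in> M_P ZG u lam. phi_P u lam p \<in> open_face u lam I}"

definition stratum :: "'n set \<Rightarrow> (complex^'n::finite) set" where
  "stratum I = {z. \<forall>j. z $ j = 0 \<longleftrightarrow> j \<in> I}"

text \<open>
  \<open>M_face\<close> is the regular Kaehler quotient of \<open>stratum I\<close> at level \<open>nu\<close>. The quotient of \<open>K\<close>
  acting freely on \<open>stratum I\<close> has the same orbits and the same orbit directions as \<open>K\<close>.
\<close>

definition level_stratum ::
  "('n::finite \<Rightarrow> 'g::real_normed_vector) \<Rightarrow> ('n \<Rightarrow> real) \<Rightarrow> 'n set \<Rightarrow> (complex^'n) set" where
  "level_stratum u lam I = level_set u lam \<inter> stratum I"

definition T_M_face ::
  "'g::real_normed_vector set \<Rightarrow> ('n::finite \<Rightarrow> 'g) \<Rightarrow> ('n \<Rightarrow> real) \<Rightarrow> 'n set \<Rightarrow> 'n qpoint \<Rightarrow>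
   'n qtangent set" where
  "T_M_face ZG u lam I = q_tangent_space (level_stratum u lam I) (K_group ZG u) (k_alg u)"

definition omega_face ::
  "'g::real_normed_vector set \<Rightarrow> ('n::finite \<Rightarrow> 'g) \<Rightarrow> ('n \<Rightarrow> real) \<Rightarrow> 'n set \<Rightarrow>
   'n qtangent \<Rightarrow> 'n qtangent \<Rightarrow> complex" where
  "omega_face ZG u lam I = reduced_form (level_stratum u lam I) (K_group ZG u) (k_alg u)"

definition del_dbar_face ::
  "'g::real_normed_vector set \<Rightarrow> ('n::finite \<Rightarrow> 'g) \<Rightarrow> ('n \<Rightarrow> real) \<Rightarrow> 'n set \<Rightarrow>
   ('n qpoint \<Rightarrow> real) \<Rightarrow> 'n qtangent \<Rightarrow> 'n qtangent \<Rightarrow> complex" where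
  "del_dbar_face ZG u lam I f =
     del_form (level_stratum u lam I) (K_group ZG u) (k_alg u)
       (dbar_fun (level_stratum u lam I) (K_group ZG u) (k_alg u) (\<lambda>p. complex_of_real (f p)))"

end

theory Submission
  imports Defs
begin

text \<open>
  Put \<open>c\<^sub>j = \<lambda>\<^sub>j - u\<^sub>j(\<eta>\<^sub>0)\<close>, which vanishes for \<open>j \<in> I\<close>. On the level set the value \<open>\<eta>\<close> of the moment
  map satisfies \<open>u\<^sub>j(\<eta>) - \<lambda>\<^sub>j = |z\<^sub>j|\<^sup>2\<close>, so the function in the theorem pulls back, up to a constant, to
  \<open>\<Phi>(z) = \<Sum>\<^sub>j c\<^sub>j log |z\<^sub>j|\<^sup>2 + |z\<^sub>j|\<^sup>2\<close>. The logarithms are pluriharmonic on the stratum, hence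
  \<open>\<i> \<partial>\<partial>bar \<Phi>\<close> is the flat form there. They serve to adapt \<open>\<Phi>\<close> to the quotient: on the orbit direction
  given by \<open>\<tau>\<close> in the Lie algebra of \<open>K\<close>, the form
  \<open>\<partial>bar \<Phi> = \<Sum>\<^sub>j (z\<^sub>j + c\<^sub>j / cnj z\<^sub>j) d(cnj z\<^sub>j)\<close> takes the value
  \<open>-2 \<pi> \<i> \<Sum>\<^sub>j \<tau>\<^sub>j (|z\<^sub>j|\<^sup>2 + c\<^sub>j)\<close>, and this is zero by the level equation, because
  \<open>\<Sum>\<^sub>j \<tau>\<^sub>j u\<^sub>j(\<eta>\<^sub>0) = 0\<close>. Therefore \<open>\<partial>bar\<close> of the descended function pulls back to the restriction
  of \<open>\<partial>bar \<Phi>\<close> to the level set (\<open>dbar_fun_dproj\<close>), although the complex structure of the quotient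
  involves a projection to the horizontal space.

  It remains to differentiate this 1-form along maps \<open>s\<close> from the plane into the level set
  (\<open>plot_curl\<close>). The terms with a mixed second derivative of \<open>s\<close> cancel by its symmetry, the terms with
  \<open>c\<^sub>j\<close> cancel because \<open>d(cnj z\<^sub>j) / cnj z\<^sub>j\<close> is closed, and what is left is \<open>-\<i>\<close> times the flat form. The
  flat form is invariant under the torus and under multiplication by \<open>\<i>\<close>, and orbit directions are
  in its kernel on the tangent spaces of the level set, so it descends (\<open>flat_form_representatives\<close>),
  and the exterior derivative is already of type (1,1).

  The operations on the quotient are descriptions in terms of curves and surfaces in the level set.
  That such descriptions have exactly one solution rests on two facts: tangent vectors of the
  quotient determine their representatives up to \<open>K\<close> and orbit directions (\<open>dproj_eqE\<close>), and the
  tangent space of the level set is cut out by the linearised equations, each linear map into it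
  being the derivative of an explicit smooth map into the level set (\<open>plot_with_derivative\<close>).
\<close>

section \<open>Smoothness of products of exponentials and powers\<close>

lemma frechet_derivative_cong_open:
  assumes "open U" "x \<in> U" "\<And>y. y \<in> U \<Longrightarrow> f y = g y"
  shows "frechet_derivative f (at x) = frechet_derivative g (at x)"
proof -
  have "(f has_derivative D) (at x) \<longleftrightarrow> (g has_derivative D) (at x)" for D
    using assms by (metis has_derivative_transform_within_open)
  then show ?thesis unfolding frechet_derivative_def by simp
qed

lemma Ck_on_cong:
  assumes "open U" "\<And>x. x \<in> U \<Longrightarrow> f x = g x"
  shows "Ck_on k U f \<longleftrightarrow> Ck_on k U g"
  using assms(2)
proof (induction k arbitrary: f g)
  case 0
  then show ?case by (simp cong: continuous_on_cong)
next
  case (Suc k)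
  have "f differentiable at x \<longleftrightarrow> g differentiable at x" if "x \<in> U" for x
    unfolding differentiable_def
    using assms(1) that Suc.prems by (metis has_derivative_transform_within_open)
  moreover have "Ck_on k U (\<lambda>x. frechet_derivative f (at x) v) \<longleftrightarrow>
      Ck_on k U (\<lambda>x. frechet_derivative g (at x) v)" for v
    by (rule Suc.IH) (metis frechet_derivative_cong_open[OF assms(1)] Suc.prems)
  ultimately show ?case by simp
qed

lemma Ck_on_add:
  assumes "open U" "Ck_on k U f" "Ck_on k U g"
  shows "Ck_on k U (\<lambda>x. f x + g x)"
  using assms(2,3)
proof (induction k arbitrary: f g)
  case 0
  then show ?case by (auto intro: continuous_on_add)
next
  case (Suc k)
  have "Ck_on k U (\<lambda>x. frechet_derivative (\<lambda>x. f x + g x) (at x) v)" for v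
  proof -
    have "Ck_on k U (\<lambda>x. frechet_derivative f (at x) v + frechet_derivative g (at x) v)"
      using Suc by auto
    moreover have "frechet_derivative (\<lambda>x. f x + g x) (at x) v =
        frechet_derivative f (at x) v + frechet_derivative g (at x) v" if "x \<in> U" for x
    proof -
      have "(f has_derivative frechet_derivative f (at x)) (at x)"
        "(g has_derivative frechet_derivative g (at x)) (at x)"
        using Suc.prems that by (simp_all add: frechet_derivative_works)
      from frechet_derivative_at[OF has_derivative_add[OF this]] show ?thesis
        by (metis (no_types))
    qed
    ultimately show ?thesis
      using Ck_on_cong[OF assms(1)] by (metis (no_types, lifting))
  qed
  then show ?case using Suc.prems by (auto intro: differentiable_add)
qed

lemma has_derivative_vec:
  fixes f :: "'a::real_normed_vector \<Rightarrow> ('b::euclidean_space)^'n"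
  assumes "\<And>j. ((\<lambda>x. f x $ j) has_derivative (\<lambda>h. f' h $ j)) (at x)"
  shows "(f has_derivative f') (at x)"
proof -
  have "((\<lambda>x. inner (f x) b) has_derivative (\<lambda>h. inner (f' h) b)) (at x)"
    if b: "b \<in> Basis" for b
  proof -
    obtain i b' where "b = axis i b'" using b by (auto simp: Basis_vec_def)
    then show ?thesis using has_derivative_inner_left[OF assms[of i], of b']
      by (simp add: inner_axis)
  qed
  then show ?thesis using has_derivative_componentwise_within[of f f' x UNIV] by simp
qed

text \<open>
  The maps that witness tangent vectors have this form, with \<open>p = 1/2\<close>. Arbitrary \<open>C\<close> and \<open>p\<close> are
  admitted because the directional derivatives are then sums of two maps of the same form, which
  gives smoothness by induction on the order of differentiation.
\<close>
definition exp_powr ::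
  "('a \<Rightarrow> complex^'n) \<Rightarrow> ('a \<Rightarrow> real^'n) \<Rightarrow> complex^'n::finite \<Rightarrow> real \<Rightarrow> 'a \<Rightarrow> complex^'n" where
  "exp_powr a l C p x = (\<chi> j. C $ j * exp (a x $ j) * of_real ((1 + l x $ j) powr p))"

lemma has_derivative_exp_powr:
  fixes a :: "'a::real_normed_vector \<Rightarrow> complex^'n::finite" and l :: "'a \<Rightarrow> real^'n"
  assumes a: "bounded_linear a" and l: "bounded_linear l" and pos: "\<And>j. 1 + l x $ j > 0"
  shows "(exp_powr a l C p has_derivative
     (\<lambda>v. exp_powr a l (C * a v) p x + exp_powr a l (\<chi> j. C $ j * of_real (p * l v $ j)) (p - 1) x)) (at x)"
proof (rule has_derivative_vec)
  fix j
  have da: "((\<lambda>x. a x $ j) has_derivative (\<lambda>h. a h $ j)) (at x)"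
    using bounded_linear_compose[OF bounded_linear_vec_nth a] by (rule bounded_linear_imp_has_derivative)
  have dl: "((\<lambda>x. l x $ j) has_derivative (\<lambda>h. l h $ j)) (at x)"
    using bounded_linear_compose[OF bounded_linear_vec_nth l] by (rule bounded_linear_imp_has_derivative)
  have de: "((\<lambda>x. exp (a x $ j)) has_derivative (\<lambda>h. exp (a x $ j) * a h $ j)) (at x)"
    using has_derivative_compose[OF da, of exp "\<lambda>h. exp (a x $ j) * h"]
      DERIV_exp[of "a x $ j"] by (simp add: has_field_derivative_def)
  have "((\<lambda>y. (1 + l y $ j) powr p) has_derivative (\<lambda>h. p * (1 + l x $ j) powr (p - 1) * l h $ j)) (at x)"
  proof -
    have "((\<lambda>r. (1 + r) powr p) has_real_derivative p * (1 + l x $ j) powr (p - 1)) (at (l x $ j))"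
      using pos[of j] by (auto intro!: derivative_eq_intros)
    from has_derivative_compose[OF dl this[unfolded has_field_derivative_def]]
    show ?thesis by simp
  qed
  from has_derivative_of_real[OF this]
  have dp: "((\<lambda>y. complex_of_real ((1 + l y $ j) powr p)) has_derivative
     (\<lambda>h. of_real (p * (1 + l x $ j) powr (p - 1) * l h $ j))) (at x)" .
  have "((\<lambda>y. C $ j * exp (a y $ j) * of_real ((1 + l y $ j) powr p)) has_derivative
     (\<lambda>h. C $ j * exp (a x $ j) * of_real (p * (1 + l x $ j) powr (p - 1) * l h $ j) +
        C $ j * (exp (a x $ j) * a h $ j) * of_real ((1 + l x $ j) powr p))) (at x)"
    by (rule has_derivative_mult[OF has_derivative_mult_right[OF de] dp])
  then show "((\<lambda>x. exp_powr a l C p x $ j) has_derivative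
     (\<lambda>h. (exp_powr a l (C * a h) p x +
        exp_powr a l (\<chi> j. C $ j * of_real (p * l h $ j)) (p - 1) x) $ j)) (at x)"
    by (simp add: exp_powr_def algebra_simps)
qed

lemma Ck_on_exp_powr:
  fixes a :: "'a::real_normed_vector \<Rightarrow> complex^'n::finite" and l :: "'a \<Rightarrow> real^'n"
  assumes a: "bounded_linear a" and l: "bounded_linear l" and U: "open U"
    and pos: "\<And>x j. x \<in> U \<Longrightarrow> 1 + l x $ j > 0"
  shows "Ck_on k U (exp_powr a l C p)"
proof (induction k arbitrary: C p)
  case 0
  show ?case
    using has_derivative_continuous[OF has_derivative_exp_powr[OF a l pos]]
    by (simp add: continuous_at_imp_continuous_on)
next
  case (Suc k)
  have fd: "frechet_derivative (exp_powr a l C p) (at x) v =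
      exp_powr a l (C * a v) p x + exp_powr a l (\<chi> j. C $ j * of_real (p * l v $ j)) (p - 1) x"
    if "x \<in> U" for x v
    using fun_cong[OF frechet_derivative_at[OF has_derivative_exp_powr[OF a l pos[OF that]]], where x = v]
    by (rule sym)
  have "Ck_on k U (\<lambda>x. frechet_derivative (exp_powr a l C p) (at x) v)" for v
    by (rule iffD2[OF Ck_on_cong[OF U fd]], assumption, rule Ck_on_add[OF U Suc.IH Suc.IH])
  moreover have "exp_powr a l C p differentiable at x" if "x \<in> U" for x
    using has_derivative_exp_powr[OF a l pos[OF that]] by (rule differentiableI)
  ultimately show ?case by simp
qed

section \<open>Symmetry of mixed partial derivatives\<close>

text \<open>
  The second difference over a square with corner \<open>0\<close> and side \<open>h\<close> equals \<open>h\<^sup>2\<close> times a value of either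
  mixed partial derivative in the square, by two applications of the mean value theorem in each of
  the two orders; \<open>h\<close> then tends to \<open>0\<close>.
\<close>
lemma mixed_partials_eq_real:
  fixes f fx fy fxy fyx :: "real \<times> real \<Rightarrow> real"
  assumes U: "open U" "0 \<in> U"
    and d1: "\<And>x y. (x, y) \<in> U \<Longrightarrow> ((\<lambda>t. f (t, y)) has_real_derivative fx (x, y)) (at x)"
    and d2: "\<And>x y. (x, y) \<in> U \<Longrightarrow> ((\<lambda>t. f (x, t)) has_real_derivative fy (x, y)) (at y)"
    and d12: "\<And>x y. (x, y) \<in> U \<Longrightarrow> ((\<lambda>t. fx (x, t)) has_real_derivative fxy (x, y)) (at y)"
    and d21: "\<And>x y. (x, y) \<in> U \<Longrightarrow> ((\<lambda>t. fy (t, y)) has_real_derivative fyx (x, y)) (at x)"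
    and c: "isCont fxy 0" "isCont fyx 0"
  shows "fxy 0 = fyx 0"
proof (rule ccontr)
  define e where "e = \<bar>fxy 0 - fyx 0\<bar> / 2"
  assume "fxy 0 \<noteq> fyx 0"
  then have e: "e > 0" by (simp add: e_def)
  obtain d0 where d0: "d0 > 0" "ball 0 d0 \<subseteq> U" using U by (meson open_contains_ball)
  obtain da where da: "da > 0" "\<And>p. dist p 0 < da \<Longrightarrow> dist (fxy p) (fxy 0) < e"
    using c(1) e unfolding continuous_at_eps_delta by metis
  obtain db where db: "db > 0" "\<And>p. dist p 0 < db \<Longrightarrow> dist (fyx p) (fyx 0) < e"
    using c(2) e unfolding continuous_at_eps_delta by metis
  define d where "d = min d0 (min da db)"
  \<comment> \<open>a divisor greater than \<open>2\<close> keeps the whole square inside the ball of radius \<open>d\<close>\<close>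
  define h where "h = d / 3"
  have h: "h > 0" using d0 da db by (simp add: h_def d_def)
  have small: "dist (x, y) 0 < d" if "0 \<le> x" "x \<le> h" "0 \<le> y" "y \<le> h" for x y :: real
  proof -
    have "norm (x, y) \<le> norm x + norm y" by (rule norm_Pair_le)
    also have "\<dots> < d" using that h by (simp add: h_def)
    finally show ?thesis by simp
  qed
  have inU: "(x, y) \<in> U" if "0 \<le> x" "x \<le> h" "0 \<le> y" "y \<le> h" for x y :: real
    using small[OF that] d0(2) by (auto simp: d_def dist_commute)
  have dx: "((\<lambda>t. f (t, h) - f (t, 0)) has_real_derivative fx (t, h) - fx (t, 0)) (at t)"
    if "0 \<le> t" "t \<le> h" for t
    using that h by (intro DERIV_diff d1 inU) auto
  have dy: "((\<lambda>t. f (h, t) - f (0, t)) has_real_derivative fy (h, t) - fy (0, t)) (at t)"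
    if "0 \<le> t" "t \<le> h" for t
    using that h by (intro DERIV_diff d2 inU) auto
  obtain \<xi> where \<xi>: "0 < \<xi>" "\<xi> < h"
    "(f (h, h) - f (h, 0)) - (f (0, h) - f (0, 0)) = h * (fx (\<xi>, h) - fx (\<xi>, 0))"
    using MVT2[OF h dx] by auto
  obtain \<eta> where \<eta>: "0 < \<eta>" "\<eta> < h" "fx (\<xi>, h) - fx (\<xi>, 0) = h * fxy (\<xi>, \<eta>)"
    using MVT2[OF h, of "\<lambda>t. fx (\<xi>, t)" "\<lambda>t. fxy (\<xi>, t)"] d12 inU \<xi> by auto
  obtain \<eta>' where \<eta>': "0 < \<eta>'" "\<eta>' < h"
    "(f (h, h) - f (0, h)) - (f (h, 0) - f (0, 0)) = h * (fy (h, \<eta>') - fy (0, \<eta>'))"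
    using MVT2[OF h dy] by auto
  obtain \<xi>' where \<xi>': "0 < \<xi>'" "\<xi>' < h" "fy (h, \<eta>') - fy (0, \<eta>') = h * fyx (\<xi>', \<eta>')"
    using MVT2[OF h, of "\<lambda>t. fy (t, \<eta>')" "\<lambda>t. fyx (t, \<eta>')"] d21 inU \<eta>' by auto
  have "h * (h * fxy (\<xi>, \<eta>)) = h * (h * fyx (\<xi>', \<eta>'))"
    using \<xi>(3) \<eta>(3) \<eta>'(3) \<xi>'(3) by (simp add: algebra_simps)
  then have eq: "fxy (\<xi>, \<eta>) = fyx (\<xi>', \<eta>')" using h by simp
  have "dist (fxy (\<xi>, \<eta>)) (fxy 0) < e" "dist (fyx (\<xi>', \<eta>')) (fyx 0) < e"
    using small[of \<xi> \<eta>] small[of \<xi>' \<eta>'] \<xi> \<eta> \<xi>' \<eta>' da db by (auto simp: d_def)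
  then show False using eq by (auto simp: e_def dist_real_def abs_if split: if_splits)
qed

lemma has_derivative_imp_partial:
  assumes "(f has_derivative D) (at (x, y))"
  shows "((\<lambda>t. f (t, y)) has_vector_derivative D (1, 0)) (at (x::real))"
    and "((\<lambda>t. f (x, t)) has_vector_derivative D (0, 1)) (at (y::real))"
proof -
  have lin: "linear D" using assms has_derivative_linear by blast
  have "((\<lambda>t. (t, y)) has_derivative (\<lambda>h. (h, 0))) (at x)"
    by (intro has_derivative_Pair has_derivative_ident has_derivative_const)
  from has_derivative_compose[OF this assms]
  have "((\<lambda>t. f (t, y)) has_derivative (\<lambda>h. D (h, 0))) (at x)" .
  moreover have "(\<lambda>h. D (h, 0)) = (\<lambda>h. h *\<^sub>R D (1, 0))"
  proof
    show "D (h, 0) = h *\<^sub>R D (1, 0)" for h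
      unfolding linear_scale[OF lin, symmetric] by simp
  qed
  ultimately show "((\<lambda>t. f (t, y)) has_vector_derivative D (1, 0)) (at x)"
    by (simp add: has_vector_derivative_def)
  have "((\<lambda>t. (x, t)) has_derivative (\<lambda>h. (0, h))) (at y)"
    by (intro has_derivative_Pair has_derivative_ident has_derivative_const)
  from has_derivative_compose[OF this assms]
  have "((\<lambda>t. f (x, t)) has_derivative (\<lambda>h. D (0, h))) (at y)" .
  moreover have "(\<lambda>h. D (0, h)) = (\<lambda>h. h *\<^sub>R D (0, 1))"
  proof
    show "D (0, h) = h *\<^sub>R D (0, 1)" for h
      unfolding linear_scale[OF lin, symmetric] by simp
  qed
  ultimately show "((\<lambda>t. f (x, t)) has_vector_derivative D (0, 1)) (at y)"
    by (simp add: has_vector_derivative_def)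
qed

lemma mixed_partials_eq:
  fixes s :: "real \<times> real \<Rightarrow> 'b::euclidean_space"
  assumes U: "open U" "0 \<in> U" and C: "Ck_on 2 U s"
  shows "frechet_derivative (\<lambda>p. frechet_derivative s (at p) (1, 0)) (at 0) (0, 1) =
         frechet_derivative (\<lambda>p. frechet_derivative s (at p) (0, 1)) (at 0) (1, 0)"
proof -
  let ?s1 = "\<lambda>p. frechet_derivative s (at p) (1, 0)"
  let ?s2 = "\<lambda>p. frechet_derivative s (at p) (0, 1)"
  let ?s12 = "\<lambda>p. frechet_derivative ?s1 (at p) (0, 1)"
  let ?s21 = "\<lambda>p. frechet_derivative ?s2 (at p) (1, 0)"
  have D: "(s has_derivative frechet_derivative s (at p)) (at p)"
    "(?s1 has_derivative frechet_derivative ?s1 (at p)) (at p)"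
    "(?s2 has_derivative frechet_derivative ?s2 (at p)) (at p)" if "p \<in> U" for p
    using C that by (auto simp: numeral_2_eq_2 frechet_derivative_works)
  have cont: "isCont ?s12 0" "isCont ?s21 0"
    using C U by (auto simp: numeral_2_eq_2 continuous_on_eq_continuous_at)
  have coord: "((\<lambda>t. inner (g t) b) has_real_derivative inner d b) (at t0)"
    if "(g has_vector_derivative d) (at t0)" for g :: "real \<Rightarrow> 'b" and d b t0
  proof -
    have "((\<lambda>t. inner (g t) b) has_derivative (\<lambda>h. inner (h *\<^sub>R d) b)) (at t0)"
      using that unfolding has_vector_derivative_def by (rule has_derivative_inner_left)
    then show ?thesis by (simp add: has_field_derivative_def mult_commute_abs)
  qed
  have "inner (?s12 0) b = inner (?s21 0) b" for b
  proof (rule mixed_partials_eq_real[OF U, where f = "\<lambda>p. inner (s p) b" and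
        fx = "\<lambda>p. inner (?s1 p) b" and fy = "\<lambda>p. inner (?s2 p) b" and
        fxy = "\<lambda>p. inner (?s12 p) b" and fyx = "\<lambda>p. inner (?s21 p) b"])
    fix x y assume p: "(x, y) \<in> U"
    show "((\<lambda>t. inner (s (t, y)) b) has_real_derivative inner (?s1 (x, y)) b) (at x)"
      by (rule coord[OF has_derivative_imp_partial(1)[OF D(1)[OF p]]])
    show "((\<lambda>t. inner (s (x, t)) b) has_real_derivative inner (?s2 (x, y)) b) (at y)"
      by (rule coord[OF has_derivative_imp_partial(2)[OF D(1)[OF p]]])
    show "((\<lambda>t. inner (?s1 (x, t)) b) has_real_derivative inner (?s12 (x, y)) b) (at y)"
      by (rule coord[OF has_derivative_imp_partial(2)[OF D(2)[OF p]]])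
    show "((\<lambda>t. inner (?s2 (t, y)) b) has_real_derivative inner (?s21 (x, y)) b) (at x)"
      by (rule coord[OF has_derivative_imp_partial(1)[OF D(3)[OF p]]])
  qed (use cont in \<open>auto intro: isCont_inner\<close>)
  then show ?thesis by (meson vector_eq_rdot)
qed

section \<open>The level set in a stratum and its tangent spaces\<close>

lemma complex_inner_combine: "of_real (inner x y) + \<i> * of_real (inner x (\<i> * y)) = x * cnj y"
  by (simp add: complex_eq_iff inner_complex_def)

lemma has_vector_derivative_frechet:
  fixes s :: "real \<Rightarrow> 'b::real_normed_vector"
  assumes "s differentiable (at x)"
  shows "(s has_vector_derivative frechet_derivative s (at x) 1) (at x)"
  using assms by (simp add: frechet_derivative_eq_vector_derivative flip: vector_derivative_works)

text \<open>
  The reduction of a stratum by a group of unitary diagonal matrices, at the level where the moment map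
  is the restriction of \<open>-c\<close> to \<open>k\<close>. Among the functionals with this restriction there is one that
  vanishes on the coordinates in \<open>I\<close> as soon as the level set meets the stratum, namely the value of
  the moment map of the full torus at a point of both.
\<close>
locale stratum_reduction =
  fixes K :: "(complex^'n::finite) set" and k :: "(real^'n) set"
    and c :: "'n \<Rightarrow> real" and I :: "'n set"
  assumes one_K: "1 \<in> K"
    and mult_K: "a \<in> K \<Longrightarrow> b \<in> K \<Longrightarrow> a * b \<in> K"
    and inverse_K: "a \<in> K \<Longrightarrow> \<exists>b\<in>K. b * a = 1"
    and unit_K: "a \<in> K \<Longrightarrow> cmod (a $ j) = 1"
    and subspace_k: "subspace k"
    and c_zero: "j \<in> I \<Longrightarrow> c j = 0"
begin

definition level :: "(complex^'n) set" where
  "level = {z \<in> stratum I. \<forall>t\<in>k. (\<Sum>j\<in>UNIV. t $ j * ((cmod (z $ j))\<^sup>2 + c j)) = 0}"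

text \<open>The solutions of the linearised equations of the level set, \<open>tangent_space_level\<close> below.\<close>
definition tangents :: "complex^'n \<Rightarrow> (complex^'n) set" where
  "tangents z = {v. (\<forall>j\<in>I. v $ j = 0) \<and> (\<forall>t\<in>k. (\<Sum>j\<in>UNIV. t $ j * inner (z $ j) (v $ j)) = 0)}"

lemma level_zero_iff: "z \<in> level \<Longrightarrow> z $ j = 0 \<longleftrightarrow> j \<in> I"
  by (auto simp: level_def stratum_def)

lemma subspace_tangents: "subspace (tangents z)"
  unfolding subspace_def tangents_def
  by (auto simp: inner_add_right distrib_left sum.distrib
      sum_distrib_left[symmetric] mult.left_commute[of _ "_::real"])

lemma has_derivative_in_tangents:
  assumes U: "open U" "x \<in> U" "s ` U \<subseteq> level" and D: "(s has_derivative D) (at x)"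
  shows "D e \<in> tangents (s x)"
proof -
  have comp: "((\<lambda>y. s y $ j) has_derivative (\<lambda>h. D h $ j)) (at x)" for j
    by (rule bounded_linear.has_derivative[OF bounded_linear_vec_nth D])
  have const: "D' = (\<lambda>h. 0)"
    if "(f has_derivative D') (at x)" "\<And>y. y \<in> U \<Longrightarrow> f y = 0"
    for f :: "'a \<Rightarrow> 'b::real_normed_vector" and D'
  proof -
    have "((\<lambda>_. 0) has_derivative D') (at x)"
      by (rule has_derivative_transform_within_open[OF that(1) U(1,2)]) (rule that(2))
    then show ?thesis using has_derivative_unique has_derivative_const by blast
  qed
  have "D e $ j = 0" if "j \<in> I" for j
  proof -
    have "s y $ j = 0" if "y \<in> U" for y
      using U(3) \<open>j \<in> I\<close> that level_zero_iff by blast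
    from const[OF comp this] show ?thesis by metis
  qed
  moreover have "(\<Sum>j\<in>UNIV. t $ j * inner (s x $ j) (D e $ j)) = 0" if "t \<in> k" for t
  proof -
    have "((\<lambda>y. \<Sum>j\<in>UNIV. t $ j * (inner (s y $ j) (s y $ j) + c j)) has_derivative
       (\<lambda>h. \<Sum>j\<in>UNIV. t $ j * (inner (s x $ j) (D h $ j) + inner (D h $ j) (s x $ j) + 0))) (at x)"
      by (intro has_derivative_sum has_derivative_mult_right has_derivative_add
          has_derivative_inner comp has_derivative_const)
    moreover have "(\<Sum>j\<in>UNIV. t $ j * (inner (s y $ j) (s y $ j) + c j)) = 0" if "y \<in> U" for y
      using that U(3) \<open>t \<in> k\<close> by (auto simp: level_def power2_norm_eq_inner)
    ultimately have "(\<lambda>h. \<Sum>j\<in>UNIV. t $ j * (inner (s x $ j) (D h $ j) + inner (D h $ j) (s x $ j) + 0)) = (\<lambda>h. 0)"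
      by (rule const)
    from fun_cong[OF this, of e]
    have "(\<Sum>j\<in>UNIV. 2 * (t $ j * inner (s x $ j) (D e $ j))) = 0"
      by (simp add: inner_commute algebra_simps)
    then show ?thesis by (simp flip: sum_distrib_left)
  qed
  ultimately show ?thesis by (simp add: tangents_def)
qed

text \<open>
  With \<open>q = D h / z\<close>, formed coordinatewise off \<open>I\<close>, the map sends \<open>h\<close> to the point with coordinates
  \<open>z\<^sub>j exp(\<i> Im q\<^sub>j) sqrt(1 + 2 Re q\<^sub>j)\<close>. The squared moduli of its coordinates are affine in \<open>h\<close>, so that
  the linearised equations for \<open>D\<close> imply the exact equations of the level set.
\<close>
lemma plot_with_derivative:
  fixes D :: "'a::euclidean_space \<Rightarrow> complex^'n"
  assumes z: "z \<in> level" and D: "linear D" and Dtan: "\<And>h. D h \<in> tangents z"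
  obtains U s where "smooth_plot level U s" "s 0 = z" "(s has_derivative D) (at 0)"
proof -
  \<comment> \<open>for \<open>j \<in> I\<close> the quotients have denominator \<open>0\<close> and are \<open>0\<close>, consistently with \<open>D h $ j = 0\<close>\<close>
  define a where "a h = (\<chi> j. \<i> * of_real (Im (D h $ j / z $ j)))" for h
  define l :: "'a \<Rightarrow> real^'n" where "l h = (\<chi> j. 2 * Re (D h $ j / z $ j))" for h
  define U where "U = (\<Inter>j. {h. 0 < 1 + l h $ j})"
  define s where "s = exp_powr a l z (1 / 2)"
  have "linear a" "linear l"
    by (auto intro!: linearI simp: a_def l_def vec_eq_iff linear_add[OF D] linear_scale[OF D]
        add_divide_distrib algebra_simps scaleR_conv_of_real[where 'a = complex]
        simp flip: times_divide_eq_right)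
  then have bl: "bounded_linear a" "bounded_linear l"
    by (simp_all add: linear_conv_bounded_linear)
  have a0: "a 0 = 0" "l 0 = 0"
    using \<open>linear a\<close> \<open>linear l\<close> by (simp_all add: linear_0)
  have pos: "0 < 1 + l h $ j" if "h \<in> U" for h j
    using that by (simp add: U_def)
  have "open U"
    unfolding U_def
    by (intro open_INT finite ballI open_Collect_less continuous_intros
        linear_continuous_on bounded_linear_compose[OF bounded_linear_vec_nth bl(2)])
  moreover have "0 \<in> U" by (simp add: U_def a0)
  moreover have "Ck_on m U s" for m
    unfolding s_def by (rule Ck_on_exp_powr[OF bl \<open>open U\<close> pos])
  moreover have "s h \<in> level" if h: "h \<in> U" for h
  proof -
    have "s h $ j = 0 \<longleftrightarrow> j \<in> I" for j
      using pos[OF h, of j] level_zero_iff[OF z, of j] by (simp add: s_def exp_powr_def)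
    moreover have "(\<Sum>j\<in>UNIV. t $ j * ((cmod (s h $ j))\<^sup>2 + c j)) = 0" if t: "t \<in> k" for t
    proof -
      have sq: "(cmod (s h $ j))\<^sup>2 = (cmod (z $ j))\<^sup>2 + 2 * inner (z $ j) (D h $ j)" for j
      proof -
        have "cmod (s h $ j) = cmod (z $ j) * (1 + l h $ j) powr (1 / 2)"
          by (simp add: s_def exp_powr_def a_def norm_mult)
        moreover have "((1 + l h $ j) powr (1 / 2))\<^sup>2 = 1 + l h $ j"
          using pos[OF h, of j] by (simp add: powr_half_sqrt)
        ultimately have "(cmod (s h $ j))\<^sup>2 = (cmod (z $ j))\<^sup>2 * (1 + l h $ j)"
          by (simp add: power_mult_distrib)
        moreover have "(cmod (z $ j))\<^sup>2 * Re (D h $ j / z $ j) = inner (z $ j) (D h $ j)"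
        proof (cases "z $ j = 0")
          case False
          have "inner (z $ j) (z $ j * q) = (cmod (z $ j))\<^sup>2 * Re q" for q
            unfolding cmod_power2 by (simp add: inner_complex_def power2_eq_square algebra_simps)
          from this[of "D h $ j / z $ j"] False show ?thesis by simp
        qed simp
        ultimately show ?thesis by (simp add: l_def algebra_simps)
      qed
      have "(\<Sum>j\<in>UNIV. t $ j * ((cmod (s h $ j))\<^sup>2 + c j)) =
          (\<Sum>j\<in>UNIV. t $ j * ((cmod (z $ j))\<^sup>2 + c j)) + 2 * (\<Sum>j\<in>UNIV. t $ j * inner (z $ j) (D h $ j))"
        unfolding sq by (simp add: sum_distrib_left sum.distrib algebra_simps)
      then show ?thesis using t z Dtan[of h] by (simp add: level_def tangents_def)
    qed
    ultimately show ?thesis by (simp add: level_def stratum_def)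
  qed
  ultimately have "smooth_plot level U s" by (auto simp: smooth_plot_def)
  moreover have "s 0 = z"
    by (simp add: s_def exp_powr_def a0 vec_eq_iff)
  moreover have "(s has_derivative D) (at 0)"
  proof -
    have "exp_powr a l (z * a h) (1/2) 0 + exp_powr a l (\<chi> j. z $ j * of_real (1/2 * l h $ j)) (1/2 - 1) 0 = D h" for h
    proof -
      have "z $ j * a h $ j + z $ j * of_real (Re (D h $ j / z $ j)) = D h $ j" for j
      proof -
        have "z $ j * a h $ j + z $ j * of_real (Re (D h $ j / z $ j)) = z $ j * (D h $ j / z $ j)"
          unfolding a_def by (subst (6) complex_eq) (simp add: algebra_simps)
        also have "\<dots> = D h $ j"
          using level_zero_iff[OF z, of j] Dtan[of h] by (auto simp: tangents_def)
        finally show ?thesis .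
      qed
      moreover have "1/2 * l h $ j = Re (D h $ j / z $ j)" for j by (simp add: l_def)
      moreover have "l 0 $ j = 0" "a 0 $ j = 0" for j using a0 by simp_all
      ultimately show ?thesis unfolding exp_powr_def by (simp add: vec_eq_iff)
    qed
    then show ?thesis
      using has_derivative_exp_powr[OF bl pos[OF \<open>0 \<in> U\<close>], of z "1/2"] by (simp add: s_def)
  qed
  ultimately show ?thesis using that by blast
qed

lemma tangent_space_level:
  assumes z: "z \<in> level"
  shows "tangent_space level z = tangents z"
proof (intro equalityI subsetI)
  fix v assume "v \<in> tangent_space level z"
  then obtain U and s :: "real \<Rightarrow> _" where s: "smooth_plot level U s" "s 0 = z"
    "(s has_vector_derivative v) (at 0)"
    by (auto simp: tangent_space_def)
  then show "v \<in> tangents z"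
    using has_derivative_in_tangents[of U 0 s "\<lambda>h. h *\<^sub>R v" 1]
    by (simp add: smooth_plot_def has_vector_derivative_def)
next
  fix v assume v: "v \<in> tangents z"
  have "linear (\<lambda>h::real. h *\<^sub>R v)" by (auto intro!: linearI simp: algebra_simps)
  moreover have "h *\<^sub>R v \<in> tangents z" for h using v subspace_tangents subspace_scale by blast
  ultimately obtain U s where "smooth_plot level U s" "s 0 = z" "(s has_derivative (\<lambda>h::real. h *\<^sub>R v)) (at 0)"
    by (rule plot_with_derivative[OF z])
  then show "v \<in> tangent_space level z"
    by (auto simp: tangent_space_def has_vector_derivative_def)
qed


section \<open>Tangent vectors of the quotient and the reduced form\<close>

lemma subspace_vert: "subspace (vert k z)"
proof -
  have "linear (\<lambda>\<tau>::real^'n. \<chi> j. 2 * of_real pi * \<i> * of_real (\<tau> $ j) * z $ j)"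
    by (auto intro!: linearI simp: vec_eq_iff algebra_simps scaleR_conv_of_real[where 'a = complex])
  then show ?thesis unfolding vert_def by (rule linear_subspace_image) (rule subspace_k)
qed

lemma vert_subset_tangents:
  assumes z: "z \<in> level"
  shows "vert k z \<subseteq> tangents z"
proof
  fix w assume "w \<in> vert k z"
  then obtain \<tau> where "\<tau> \<in> k" and w: "w = (\<chi> j. 2 * of_real pi * \<i> * of_real (\<tau> $ j) * z $ j)"
    by (auto simp: vert_def)
  have "inner (z $ j) (w $ j) = 0" for j by (simp add: w inner_complex_def)
  then show "w \<in> tangents z" using level_zero_iff[OF z] by (simp add: tangents_def w)
qed

lemma inner_unit_mult:
  assumes "cmod a = 1"
  shows "inner (a * x) (a * y) = inner x y"
proof -
  have "inner (a * x) (a * y) = (cmod a)\<^sup>2 * inner x y"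
    unfolding cmod_power2 by (simp add: inner_complex_def power2_eq_square algebra_simps)
  then show ?thesis using assms by simp
qed

lemma unit_K_nonzero: "a \<in> K \<Longrightarrow> a $ j \<noteq> 0"
  using unit_K[of a j] by auto

lemma act_level: "a \<in> K \<Longrightarrow> z \<in> level \<Longrightarrow> a * z \<in> level"
  by (simp add: level_def stratum_def norm_mult unit_K unit_K_nonzero)

lemma act_tangents: "a \<in> K \<Longrightarrow> v \<in> tangents z \<Longrightarrow> a * v \<in> tangents (a * z)"
  by (simp add: tangents_def inner_unit_mult unit_K)

lemma act_vert: "w \<in> vert k z \<Longrightarrow> a * w \<in> vert k (a * z)"
  by (force simp: vert_def vec_eq_iff)

lemma dproj_act_subset:
  assumes a: "a \<in> K" and w: "w \<in> vert k (a * z)"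
  shows "dproj K k (a * z) (a * v + w) \<subseteq> dproj K k z v"
proof
  fix q assume "q \<in> dproj K k (a * z) (a * v + w)"
  then obtain b w' where b: "b \<in> K" "w' \<in> vert k (b * (a * z))"
    and q: "q = (b * (a * z), b * (a * v + w) + w')"
    by (auto simp: dproj_def)
  have "b * w + w' \<in> vert k ((b * a) * z)"
    using subspace_add[OF subspace_vert act_vert[OF w] b(2)] by (simp add: mult.assoc)
  moreover have "q = ((b * a) * z, (b * a) * v + (b * w + w'))"
    by (simp add: q algebra_simps)
  ultimately show "q \<in> dproj K k z v"
    using mult_K[OF b(1) a] by (auto simp: dproj_def)
qed

text \<open>One inclusion is \<open>dproj_act_subset\<close>; the other is its instance for the inverse of \<open>a\<close>.\<close>
lemma dproj_act:
  assumes a: "a \<in> K" and w: "w \<in> vert k (a * z)"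
  shows "dproj K k (a * z) (a * v + w) = dproj K k z v"
proof
  obtain b where b: "b \<in> K" "b * a = 1" using inverse_K[OF a] by blast
  have "b * (a * z) = z" "b * (a * v + w) + - (b * w) = v"
    using b(2) by (simp_all add: algebra_simps flip: mult.assoc)
  moreover have "- (b * w) \<in> vert k (b * (a * z))"
    by (rule subspace_neg[OF subspace_vert act_vert[OF w]])
  ultimately show "dproj K k z v \<subseteq> dproj K k (a * z) (a * v + w)"
    using dproj_act_subset[OF b(1), of "- (b * w)" "a * z" "a * v + w"] by simp
qed (rule dproj_act_subset[OF a w])

lemma dproj_vert:
  assumes "w \<in> vert k z"
  shows "dproj K k z (v + w) = dproj K k z v"
  using dproj_act[OF one_K, of w z v] assms by simp

text \<open>
  As \<open>1 \<in> K\<close> and \<open>0\<close> is an orbit direction, the class of \<open>(z', v')\<close> contains this pair itself.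
\<close>
lemma dproj_eqE:
  assumes "dproj K k z v = dproj K k z' v'"
  obtains a w where "a \<in> K" "w \<in> vert k (a * z)" "z' = a * z" "v' = a * v + w"
proof -
  have "(1 * z', 1 * v' + 0) \<in> dproj K k z' v'"
    using one_K subspace_0[OF subspace_vert] unfolding dproj_def by blast
  then have "(z', v') \<in> dproj K k z v" using assms by simp
  then show ?thesis using that unfolding dproj_def by blast
qed

text \<open>
  Each of the two equations provides its own element of \<open>K\<close>. Both move \<open>z\<close> to the same point, so they
  have the same coordinates off \<open>I\<close>, where \<open>z\<close> has no zeros; on \<open>I\<close> the vector \<open>w\<close> vanishes. Hence one
  element serves for both vectors, even where \<open>K\<close> does not act freely.
\<close>
lemma dproj_eq_pairE:
  assumes "dproj K k z v = dproj K k z' v'" "dproj K k z w = dproj K k z' w'"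
    and z: "z \<in> level" and w: "w \<in> tangents z"
  obtains a v1 w1 where "a \<in> K" "v1 \<in> vert k (a * z)" "w1 \<in> vert k (a * z)"
    "z' = a * z" "v' = a * v + v1" "w' = a * w + w1"
proof -
  obtain a v1 where a: "a \<in> K" "v1 \<in> vert k (a * z)" "z' = a * z" "v' = a * v + v1"
    using assms(1) by (rule dproj_eqE)
  obtain b w1 where b: "b \<in> K" "w1 \<in> vert k (b * z)" "z' = b * z" "w' = b * w + w1"
    using assms(2) by (rule dproj_eqE)
  have "a $ j * w $ j = b $ j * w $ j" for j
  proof (cases "j \<in> I")
    case True
    then show ?thesis using w by (simp add: tangents_def)
  next
    case False
    moreover have "a $ j * z $ j = b $ j * z $ j"
      using a(3) b(3) by (metis vector_mult_component)
    ultimately have "a $ j = b $ j" using level_zero_iff[OF z] by (metis mult_right_cancel)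
    then show ?thesis by simp
  qed
  then have "a * w = b * w" by (simp add: vec_eq_iff)
  moreover have "a * z = b * z" using a b by simp
  ultimately show ?thesis using that a b by metis
qed

lemma q_tangent_space_pair:
  assumes "X \<in> q_tangent_space level K k p" "Y \<in> q_tangent_space level K k p"
  obtains z v w where "z \<in> level" "v \<in> tangents z" "w \<in> tangents z" "X = dproj K k z v" "Y = dproj K k z w"
proof -
  obtain z v where z: "z \<in> level" "proj K z = p" "v \<in> tangents z" "X = dproj K k z v"
    using assms(1) tangent_space_level by (auto simp: q_tangent_space_def)
  obtain z' w where z': "z' \<in> level" "proj K z' = p" "w \<in> tangents z'" "Y = dproj K k z' w"
    using assms(2) tangent_space_level by (auto simp: q_tangent_space_def)
  have "1 * z \<in> proj K z" using one_K unfolding proj_def by blast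
  then obtain a where a: "a \<in> K" "z = a * z'" using z(2) z'(2) by (auto simp: proj_def)
  have "a * w \<in> tangents z" using act_tangents[OF a(1) z'(3)] a(2) by simp
  moreover have "Y = dproj K k z (a * w)"
    using dproj_act[OF a(1), of 0 z' w] subspace_0[OF subspace_vert] z'(4) a(2) by simp
  ultimately show ?thesis using that z by blast
qed

lemma flat_form_antisym: "flat_form w v = - flat_form v w"
  by (simp add: flat_form_def algebra_simps sum_subtractf)

lemma flat_form_add:
  "flat_form (v + v') w = flat_form v w + flat_form v' w"
  "flat_form v (w + w') = flat_form v w + flat_form v w'"
  by (simp_all add: flat_form_def algebra_simps sum_subtractf sum.distrib)

text \<open>
  Contracting the flat form with the orbit direction of \<open>\<tau>\<close> yields a multiple of the differential of the
  \<open>\<tau>\<close>-component of the moment map, which is zero on tangent vectors of the level set.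
\<close>
lemma flat_form_vert:
  assumes v: "v \<in> tangents z" and w: "w \<in> vert k z"
  shows "flat_form v w = 0"
proof -
  obtain \<tau> where \<tau>: "\<tau> \<in> k" and w: "w = (\<chi> j. 2 * of_real pi * \<i> * of_real (\<tau> $ j) * z $ j)"
    using w by (auto simp: vert_def)
  have "v $ j * cnj (w $ j) - w $ j * cnj (v $ j) =
      - 4 * pi * \<i> * of_real (\<tau> $ j * inner (z $ j) (v $ j))" for j
    by (simp add: w complex_eq_iff inner_complex_def algebra_simps)
  then have "flat_form v w = \<i> * (- 4 * pi * \<i> * of_real (\<Sum>j\<in>UNIV. \<tau> $ j * inner (z $ j) (v $ j)))"
    by (simp add: flat_form_def sum_distrib_left)
  moreover have "(\<Sum>j\<in>UNIV. \<tau> $ j * inner (z $ j) (v $ j)) = 0"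
    using v \<tau> by (simp add: tangents_def)
  ultimately show ?thesis by simp
qed

lemma flat_form_unit:
  assumes "a \<in> K"
  shows "flat_form (a * v) (a * w) = flat_form v w"
proof -
  have "a $ j * cnj (a $ j) = 1" for j
    using unit_K[OF assms, of j] by (simp add: complex_norm_square[symmetric])
  then have "a $ j * v $ j * (cnj (a $ j) * cnj (w $ j)) = v $ j * cnj (w $ j)" for v w j
    by (metis (no_types, opaque_lifting) mult.assoc mult.commute mult.right_neutral)
  then show ?thesis
    by (simp only: flat_form_def vector_mult_component complex_cnj_mult)
qed

lemma flat_form_representatives:
  assumes "dproj K k z v = dproj K k z' v'" "dproj K k z w = dproj K k z' w'"
    and z: "z \<in> level" and v: "v \<in> tangents z" and w: "w \<in> tangents z"
  shows "flat_form v' w' = flat_form v w"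
proof -
  obtain a v1 w1 where a: "a \<in> K" "v1 \<in> vert k (a * z)" "w1 \<in> vert k (a * z)"
    "z' = a * z" "v' = a * v + v1" "w' = a * w + w1"
    using dproj_eq_pairE[OF assms(1,2) z w] by metis
  have tan: "a * v \<in> tangents (a * z)" "a * w \<in> tangents (a * z)" "v1 \<in> tangents (a * z)"
    using act_tangents[OF a(1) v] act_tangents[OF a(1) w] vert_subset_tangents[OF act_level[OF a(1) z]] a(2) by auto
  show ?thesis
    using flat_form_vert[OF tan(1) a(3)] flat_form_vert[OF tan(3) a(3)] flat_form_vert[OF tan(2) a(2)]
      flat_form_antisym[of v1 "a * w"]
    by (simp add: a(5,6) flat_form_add flat_form_unit[OF a(1)])
qed

lemma reduced_form_dproj:
  assumes z: "z \<in> level" and v: "v \<in> tangents z" and w: "w \<in> tangents z"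
  shows "reduced_form level K k (dproj K k z v) (dproj K k z w) = flat_form v w"
  unfolding reduced_form_def
proof (rule the_equality)
  show "\<exists>z'\<in>level. \<exists>v'\<in>tangent_space level z'. \<exists>w'\<in>tangent_space level z'.
     dproj K k z v = dproj K k z' v' \<and> dproj K k z w = dproj K k z' w' \<and> flat_form v w = flat_form v' w'"
    using assms tangent_space_level by blast
qed (use flat_form_representatives assms in blast)

text \<open>
  Up to a real factor, the orbit directions are \<open>\<i>\<close> times the gradients of moment map components, so that
  orthogonality of \<open>v\<close> to them is the linearised level equation for \<open>\<i> v\<close>. Hence the horizontal space
  is complex.
\<close>
lemma horizontal_iff:
  assumes z: "z \<in> level"
  shows "v \<in> horizontal level k z \<longleftrightarrow> v \<in> tangents z \<and> (\<chi> j. \<i> * v $ j) \<in> tangents z"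
proof -
  have "inner v (\<chi> j. 2 * of_real pi * \<i> * of_real (\<tau> $ j) * z $ j) =
      - 2 * pi * (\<Sum>j\<in>UNIV. \<tau> $ j * inner (z $ j) (\<i> * v $ j))" for \<tau> :: "real^'n"
    unfolding inner_vec_def sum_distrib_left
    by (rule sum.cong) (auto simp: inner_complex_def algebra_simps)
  then have "(\<forall>w\<in>vert k z. inner v w = 0) \<longleftrightarrow>
      (\<forall>\<tau>\<in>k. (\<Sum>j\<in>UNIV. \<tau> $ j * inner (z $ j) (\<i> * v $ j)) = 0)"
    by (simp add: vert_def)
  then show ?thesis
    unfolding horizontal_def tangent_space_level[OF z] by (auto simp: tangents_def)
qed

lemma horizontal_decomposition:
  assumes z: "z \<in> level" and v: "v \<in> tangents z"
  obtains h w where "h \<in> horizontal level k z" "w \<in> vert k z" "v = h + w"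
proof -
  obtain w h where w: "w \<in> span (vert k z)" and h: "\<And>x. x \<in> span (vert k z) \<Longrightarrow> orthogonal h x"
    and eq: "v = w + h"
    using orthogonal_subspace_decomp_exists[of "vert k z" v] by blast
  have w': "w \<in> vert k z" using w subspace_vert by (metis span_eq_iff)
  then have "h \<in> tangents z"
    using eq v vert_subset_tangents[OF z] subspace_diff[OF subspace_tangents v, of w] by auto
  moreover have "inner h x = 0" if "x \<in> vert k z" for x
    using h[of x] that span_base by (auto simp: orthogonal_def)
  ultimately have "h \<in> horizontal level k z"
    by (simp add: horizontal_def tangent_space_level[OF z])
  then show ?thesis using that w' eq by (simp add: add.commute)
qed

text \<open>
  Horizontal representatives of the same tangent vector differ only by the action of \<open>K\<close>, since their
  difference is an orbit direction orthogonal to the orbit; multiplication by \<open>\<i>\<close> commutes with the action.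
\<close>
lemma reduced_J_dproj:
  assumes z: "z \<in> level" and v: "v \<in> horizontal level k z"
  shows "reduced_J level K k (dproj K k z v) = dproj K k z (\<chi> j. \<i> * v $ j)"
  unfolding reduced_J_def
proof (rule the_equality)
  fix Y assume "\<exists>z'\<in>level. \<exists>v'\<in>horizontal level k z'. dproj K k z v = dproj K k z' v' \<and>
      Y = dproj K k z' (\<chi> j. \<i> * v' $ j)"
  then obtain z' v' where v': "v' \<in> horizontal level k z'" and eq: "dproj K k z v = dproj K k z' v'"
    and Y: "Y = dproj K k z' (\<chi> j. \<i> * v' $ j)" by blast
  obtain a w where a: "a \<in> K" "w \<in> vert k (a * z)" "z' = a * z" "v' = a * v + w"
    using eq by (rule dproj_eqE)
  have iv: "(\<chi> j. \<i> * (a * v) $ j) = a * (\<chi> j. \<i> * v $ j)"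
    by (simp add: vec_eq_iff algebra_simps)
  have "a * v \<in> horizontal level k (a * z)"
    using v act_tangents[OF a(1)] unfolding horizontal_iff[OF z] horizontal_iff[OF act_level[OF a(1) z]] iv by blast
  then have "inner (a * v) w = 0" "inner v' w = 0"
    using v' a(2,3) by (simp_all add: horizontal_def)
  then have "inner w w = 0" by (simp add: a(4) inner_add_left)
  then have "v' = a * v" by (simp add: a(4))
  then show "Y = dproj K k z (\<chi> j. \<i> * v $ j)"
    unfolding Y a(3) \<open>v' = a * v\<close> iv
    using dproj_act[OF a(1), of 0 z] subspace_0[OF subspace_vert] by simp
qed (use assms in blast)

section \<open>The potential and its dbar-derivative\<close>

text \<open>
  On \<open>level\<close> the coordinates in \<open>I\<close> contribute \<open>0\<close> to each of the sums below, whatever \<open>ln 0\<close> is, as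
  there \<open>c j = 0\<close> and \<open>z $ j = 0\<close>.
\<close>
definition potential :: "complex^'n \<Rightarrow> real" where
  "potential z = (\<Sum>j\<in>UNIV. c j * ln ((cmod (z $ j))\<^sup>2) + (cmod (z $ j))\<^sup>2)"

definition d_potential :: "complex^'n \<Rightarrow> complex^'n \<Rightarrow> real" where
  "d_potential z v = (\<Sum>j\<in>UNIV. 2 * (1 + c j / (cmod (z $ j))\<^sup>2) * inner (z $ j) (v $ j))"

text \<open>The (0,1)-part of the differential of \<open>potential\<close> on the stratum, before passing to the quotient.\<close>
definition dbar_potential :: "complex^'n \<Rightarrow> complex^'n \<Rightarrow> complex" where
  "dbar_potential z v = (\<Sum>j\<in>UNIV. (z $ j + c j / cnj (z $ j)) * cnj (v $ j))"

lemma c_zero_or_nonzero: "z \<in> level \<Longrightarrow> c j = 0 \<or> z $ j \<noteq> 0"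
  using level_zero_iff c_zero by blast

lemma has_vector_derivative_nth:
  "(s has_vector_derivative v) (at t) \<Longrightarrow> ((\<lambda>t. s t $ j) has_vector_derivative v $ j) (at t)"
  by (rule bounded_linear.has_vector_derivative[OF bounded_linear_vec_nth])

lemma potential_derivative:
  assumes s0: "s 0 \<in> level" and s: "(s has_vector_derivative v) (at 0)"
  shows "((\<lambda>t. potential (s t)) has_real_derivative d_potential (s 0) v) (at 0)"
  unfolding potential_def d_potential_def
proof (rule DERIV_sum)
  fix j
  have "((\<lambda>t. inner (s t $ j) (s t $ j)) has_derivative
     (\<lambda>h. inner (s 0 $ j) (h *\<^sub>R v $ j) + inner (h *\<^sub>R v $ j) (s 0 $ j))) (at 0)"
    using has_vector_derivative_nth[OF s, of j]
    by (intro has_derivative_inner) (simp_all add: has_vector_derivative_def)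
  then have sq: "((\<lambda>t. (cmod (s t $ j))\<^sup>2) has_real_derivative 2 * inner (s 0 $ j) (v $ j)) (at 0)"
    by (simp add: has_field_derivative_def power2_norm_eq_inner inner_commute mult_commute_abs algebra_simps)
  show "((\<lambda>t. c j * ln ((cmod (s t $ j))\<^sup>2) + (cmod (s t $ j))\<^sup>2) has_real_derivative
      2 * (1 + c j / (cmod (s 0 $ j))\<^sup>2) * inner (s 0 $ j) (v $ j)) (at 0)"
  proof (cases "c j = 0")
    case True
    then show ?thesis using sq by simp
  next
    case False
    then have "0 < (cmod (s 0 $ j))\<^sup>2" using c_zero_or_nonzero[OF s0, of j] by simp
    from DERIV_add[OF DERIV_cmult[OF DERIV_chain2[OF DERIV_ln[OF this] sq], of "c j"] sq]
    show ?thesis by (rule back_subst) (simp add: algebra_simps divide_inverse)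
  qed
qed

lemma d_potential_act:
  assumes "a \<in> K" "w \<in> vert k (a * z)"
  shows "d_potential (a * z) (a * v + w) = d_potential z v"
proof -
  have "inner (a $ j * z $ j) (w $ j) = 0" for j
    using assms(2) by (auto simp: vert_def inner_complex_def)
  then show ?thesis
    by (simp add: d_potential_def norm_mult unit_K[OF assms(1)] inner_add_right inner_unit_mult)
qed

text \<open>
  Any curve representing the tangent vector gives the same derivative, because \<open>d_potential\<close> vanishes on
  orbit directions and is invariant under \<open>K\<close>; a curve exists by the description of the tangent spaces.
\<close>
lemma d_fun_dproj:
  assumes f: "\<And>z. z \<in> level \<Longrightarrow> f (proj K z) = of_real (potential z + C)"
    and z: "z \<in> level" and v: "v \<in> tangents z"
  shows "d_fun level K k f (dproj K k z v) = of_real (d_potential z v)"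
proof -
  have deriv: "((\<lambda>t. f (proj K (s t))) has_vector_derivative of_real (d_potential (s 0) u)) (at 0)"
    if s: "smooth_plot level U s" "(s has_vector_derivative u) (at 0)" for U s u
  proof -
    have U: "open U" "0 \<in> U" using s(1) by (auto simp: smooth_plot_def)
    have sZ: "s t \<in> level" if "t \<in> U" for t
      using s(1) that by (auto simp: smooth_plot_def)
    have "((\<lambda>t. potential (s t) + C) has_real_derivative d_potential (s 0) u) (at 0)"
      using potential_derivative[OF sZ[OF U(2)] s(2)] by (auto intro!: derivative_eq_intros)
    then have "((\<lambda>t. complex_of_real (potential (s t) + C)) has_vector_derivative of_real (d_potential (s 0) u)) (at 0)"
      by (intro has_vector_derivative_of_real)
        (simp add: has_real_derivative_iff_has_vector_derivative)
    then show ?thesis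
      by (rule has_vector_derivative_transform_within_open[OF _ U]) (simp add: f sZ)
  qed
  show ?thesis
    unfolding d_fun_def
  proof (rule the_equality)
    obtain U and s :: "real \<Rightarrow> _" where s: "smooth_plot level U s" "s 0 = z"
      "(s has_vector_derivative v) (at 0)"
      using v unfolding tangent_space_level[OF z, symmetric] tangent_space_def by blast
    have "frechet_derivative s (at 0) 1 = v"
      using frechet_derivative_at[OF s(3)[unfolded has_vector_derivative_def]]
      by (metis scaleR_one)
    then show "\<exists>U s. smooth_plot level U s \<and> dproj K k z v = pushforward K k s 0 1 \<and>
        ((\<lambda>t. f (proj K (s t))) has_vector_derivative of_real (d_potential z v)) (at (0::real))"
      using s deriv[OF s(1,3)] by (auto simp: pushforward_def)
  next
    fix r assume "\<exists>U s. smooth_plot level U s \<and> dproj K k z v = pushforward K k s 0 1 \<and>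
        ((\<lambda>t. f (proj K (s t))) has_vector_derivative r) (at (0::real))"
    then obtain U and s :: "real \<Rightarrow> _" where s: "smooth_plot level U s"
      "dproj K k z v = dproj K k (s 0) (frechet_derivative s (at 0) 1)"
      and r: "((\<lambda>t. f (proj K (s t))) has_vector_derivative r) (at 0)"
      by (auto simp: pushforward_def)
    have "Ck_on (Suc 0) U s" "0 \<in> U" using s(1) by (auto simp: smooth_plot_def simp del: Ck_on.simps)
    then have "s differentiable (at 0)" by simp
    from deriv[OF s(1) has_vector_derivative_frechet[OF this]] r
    have "r = of_real (d_potential (s 0) (frechet_derivative s (at 0) 1))"
      using vector_derivative_unique_at by blast
    also have "\<dots> = of_real (d_potential z v)"
      using s(2) by (rule dproj_eqE) (simp add: d_potential_act)
    finally show "r = of_real (d_potential z v)" .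
  qed
qed

text \<open>
  Here the level equation enters: the value on the orbit direction of \<open>\<tau>\<close> is a multiple of
  \<open>\<Sum>\<^sub>j \<tau>\<^sub>j (|z\<^sub>j|\<^sup>2 + c\<^sub>j)\<close>. The coefficients \<open>c\<^sub>j\<close> of the logarithms are chosen for this.
\<close>
lemma dbar_potential_vert:
  assumes z: "z \<in> level" and w: "w \<in> vert k z"
  shows "dbar_potential z w = 0"
proof -
  obtain \<tau> where \<tau>: "\<tau> \<in> k" and w: "w = (\<chi> j. 2 * of_real pi * \<i> * of_real (\<tau> $ j) * z $ j)"
    using w by (auto simp: vert_def)
  have "(z $ j + c j / cnj (z $ j)) * cnj (w $ j) =
      - 2 * pi * \<i> * of_real (\<tau> $ j * ((cmod (z $ j))\<^sup>2 + c j))" for j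
  proof (cases "z $ j = 0")
    case True
    then show ?thesis using c_zero_or_nonzero[OF z, of j] by (simp add: w)
  next
    case False
    have "(z $ j + c j / cnj (z $ j)) * cnj (z $ j) = of_real ((cmod (z $ j))\<^sup>2 + c j)"
      using False unfolding of_real_add complex_norm_square by (simp add: field_simps)
    then have "(z $ j + c j / cnj (z $ j)) * cnj (w $ j) =
        - 2 * pi * \<i> * of_real (\<tau> $ j) * of_real ((cmod (z $ j))\<^sup>2 + c j)"
      by (simp add: w mult.assoc mult.left_commute)
    then show ?thesis by simp
  qed
  then have "dbar_potential z w =
      - 2 * pi * \<i> * of_real (\<Sum>j\<in>UNIV. \<tau> $ j * ((cmod (z $ j))\<^sup>2 + c j))"
    by (simp add: dbar_potential_def sum_distrib_left)
  moreover have "(\<Sum>j\<in>UNIV. \<tau> $ j * ((cmod (z $ j))\<^sup>2 + c j)) = 0"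
    using z \<tau> by (simp add: level_def)
  ultimately show ?thesis by simp
qed

lemma dbar_potential_eq:
  "dbar_potential z v =
    (of_real (d_potential z v) + \<i> * of_real (d_potential z (\<chi> j. \<i> * v $ j))) / 2"
proof -
  have "(z $ j + c j / cnj (z $ j)) * cnj (v $ j) =
     of_real (1 + c j / (cmod (z $ j))\<^sup>2) * (z $ j * cnj (v $ j))" for j
    by (cases "z $ j = 0") (simp_all add: complex_norm_square field_simps flip: of_real_power)
  then show ?thesis
    unfolding dbar_potential_def d_potential_def complex_inner_combine[symmetric]
    by (simp add: sum_distrib_left sum.distrib add_divide_distrib sum_divide_distrib algebra_simps)
qed

text \<open>
  For horizontal vectors the complex structure of the quotient is multiplication by \<open>\<i>\<close>, and both sides
  depend only on the horizontal part of \<open>v\<close>.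
\<close>
lemma dbar_fun_dproj:
  assumes f: "\<And>z. z \<in> level \<Longrightarrow> f (proj K z) = of_real (potential z + C)"
    and z: "z \<in> level" and v: "v \<in> tangents z"
  shows "dbar_fun level K k f (dproj K k z v) = dbar_potential z v"
proof -
  obtain h w where h: "h \<in> horizontal level k z" and w: "w \<in> vert k z" and eq: "v = h + w"
    using horizontal_decomposition[OF z v] .
  have "dbar_fun level K k f (dproj K k z h) = dbar_potential z h"
    using h unfolding dbar_fun_def reduced_J_dproj[OF z h] dbar_potential_eq horizontal_iff[OF z]
    by (simp add: d_fun_dproj[OF f z])
  also have "\<dots> = dbar_potential z v"
    using dbar_potential_vert[OF z w]
    by (simp add: eq dbar_potential_def distrib_left sum.distrib)
  finally show ?thesis by (simp add: eq dproj_vert[OF w])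
qed

section \<open>The exterior derivative of the dbar-derivative\<close>

lemma dbar_potential_derivative:
  assumes s0: "s 0 \<in> level" and s: "(s has_vector_derivative a) (at 0)"
    and v: "(v has_vector_derivative m) (at 0)"
  shows "((\<lambda>t. dbar_potential (s t) (v t)) has_vector_derivative
    (\<Sum>j\<in>UNIV. (a $ j - c j * cnj (a $ j) / (cnj (s 0 $ j))\<^sup>2) * cnj (v 0 $ j) +
       (s 0 $ j + c j / cnj (s 0 $ j)) * cnj (m $ j))) (at 0)"
  unfolding dbar_potential_def
proof (rule has_vector_derivative_sum)
  fix j
  have sj: "((\<lambda>t. s t $ j) has_vector_derivative a $ j) (at 0)"
    by (rule has_vector_derivative_nth[OF s])
  have cs: "((\<lambda>t. cnj (s t $ j)) has_vector_derivative cnj (a $ j)) (at 0)"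
    by (rule has_vector_derivative_cnj[OF sj])
  have cv: "((\<lambda>t. cnj (v t $ j)) has_vector_derivative cnj (m $ j)) (at 0)"
    by (rule has_vector_derivative_cnj[OF has_vector_derivative_nth[OF v]])
  have q: "((\<lambda>t. c j / cnj (s t $ j)) has_vector_derivative
      - c j * cnj (a $ j) / (cnj (s 0 $ j))\<^sup>2) (at 0)"
  proof (cases "c j = 0")
    case False
    then have nz: "cnj (s 0 $ j) \<noteq> 0" using c_zero_or_nonzero[OF s0, of j] by simp
    have "((\<lambda>y. c j / y) has_field_derivative - c j / (cnj (s 0 $ j))\<^sup>2) (at (cnj (s 0 $ j)))"
      using nz by (auto intro!: derivative_eq_intros simp: power2_eq_square)
    from field_vector_diff_chain_at[OF cs this] show ?thesis
      by (simp add: o_def mult.commute)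
  qed simp
  show "((\<lambda>t. (s t $ j + c j / cnj (s t $ j)) * cnj (v t $ j)) has_vector_derivative
    (a $ j - c j * cnj (a $ j) / (cnj (s 0 $ j))\<^sup>2) * cnj (v 0 $ j) +
       (s 0 $ j + c j / cnj (s 0 $ j)) * cnj (m $ j)) (at 0)"
    using has_vector_derivative_mult[OF has_vector_derivative_add[OF sj q] cv]
    by (simp add: add.commute)
qed

text \<open>
  In the two derivatives the terms containing a mixed second derivative of \<open>s\<close> agree, and so do the
  terms \<open>c\<^sub>j cnj(\<partial>\<^sub>1 s\<^sub>j) cnj(\<partial>\<^sub>2 s\<^sub>j) / (cnj s\<^sub>j)\<^sup>2\<close>, which are symmetric in the two directions. What remains
  comes from differentiating the factor \<open>z\<^sub>j\<close> of \<open>z\<^sub>j d(cnj z\<^sub>j)\<close>.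
\<close>
lemma plot_curl:
  assumes \<theta>: "\<And>z v. z \<in> level \<Longrightarrow> v \<in> tangents z \<Longrightarrow> \<theta> (dproj K k z v) = dbar_potential z v"
    and s: "smooth_plot level U s"
  obtains r1 r2 where
    "((\<lambda>x. \<theta> (pushforward K k s (x, 0) (0, 1))) has_vector_derivative r1) (at 0)"
    "((\<lambda>y. \<theta> (pushforward K k s (0, y) (1, 0))) has_vector_derivative r2) (at 0)"
    "r1 - r2 = - \<i> * flat_form (frechet_derivative s (at 0) (1, 0)) (frechet_derivative s (at 0) (0, 1))"
proof -
  let ?s1 = "\<lambda>p. frechet_derivative s (at p) (1, 0)"
  let ?s2 = "\<lambda>p. frechet_derivative s (at p) (0, 1)"
  define M where "M = frechet_derivative ?s2 (at 0) (1, 0)"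
  have U: "open U" "0 \<in> U" "s ` U \<subseteq> level" and C2: "Ck_on 2 U s"
    using s by (auto simp: smooth_plot_def)
  have D: "(s has_derivative frechet_derivative s (at p)) (at p)"
    "(?s1 has_derivative frechet_derivative ?s1 (at p)) (at p)"
    "(?s2 has_derivative frechet_derivative ?s2 (at p)) (at p)" if "p \<in> U" for p
    using C2 that by (auto simp: numeral_2_eq_2 frechet_derivative_works)
  have M': "frechet_derivative ?s1 (at 0) (0, 1) = M"
    unfolding M_def by (rule mixed_partials_eq[OF U(1,2) C2])
  have \<theta>s: "\<theta> (pushforward K k s p e) = dbar_potential (s p) (frechet_derivative s (at p) e)"
    if "p \<in> U" for p e
    unfolding pushforward_def
    using \<theta> has_derivative_in_tangents[OF U(1) that U(3) D(1)[OF that]] U(3) that by blast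
  have s0: "s 0 \<in> level" using U by blast
  have zz: "(0, 0) = (0 :: real \<times> real)" by (simp add: zero_prod_def)
  note P0 = D[OF U(2), folded zz]
  note d = has_derivative_imp_partial(1)[OF P0(1)] has_derivative_imp_partial(2)[OF P0(1)]
    has_derivative_imp_partial(1)[OF P0(3)] has_derivative_imp_partial(2)[OF P0(2)]
  define R where "R a b = (\<Sum>j\<in>UNIV.
      (a $ j - c j * cnj (a $ j) / (cnj (s 0 $ j))\<^sup>2) * cnj (b $ j) +
       (s 0 $ j + c j / cnj (s 0 $ j)) * cnj (M $ j))" for a b :: "complex^'n"
  have "((\<lambda>x. dbar_potential (s (x, 0)) (?s2 (x, 0))) has_vector_derivative R (?s1 0) (?s2 0)) (at 0)"
    using dbar_potential_derivative[OF _ d(1) d(3)] s0 unfolding R_def M_def zz by simp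
  then have r1: "((\<lambda>x. \<theta> (pushforward K k s (x, 0) (0, 1))) has_vector_derivative R (?s1 0) (?s2 0)) (at 0)"
  proof (rule has_vector_derivative_transform_within_open)
    show "open ((\<lambda>x. (x, 0)) -` U)" by (intro open_vimage U continuous_intros)
  qed (use U(2) \<theta>s in \<open>auto simp: zz\<close>)
  have "((\<lambda>y. dbar_potential (s (0, y)) (?s1 (0, y))) has_vector_derivative R (?s2 0) (?s1 0)) (at 0)"
    using dbar_potential_derivative[OF _ d(2) d(4)] s0 unfolding R_def M'[symmetric] zz by simp
  then have r2: "((\<lambda>y. \<theta> (pushforward K k s (0, y) (1, 0))) has_vector_derivative R (?s2 0) (?s1 0)) (at 0)"
  proof (rule has_vector_derivative_transform_within_open)
    show "open ((\<lambda>y. (0, y)) -` U)" by (intro open_vimage U continuous_intros)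
  qed (use U(2) \<theta>s in \<open>auto simp: zz\<close>)
  have "R a b - R b a = - \<i> * flat_form a b" for a b
    unfolding R_def flat_form_def sum_subtractf[symmetric]
    by (simp add: sum_distrib_left algebra_simps)
  with r1 r2 show ?thesis using that by blast
qed

text \<open>
  A surface with the tangent vectors \<open>v\<close> and \<open>w\<close> exists by \<open>plot_with_derivative\<close>; any other surface
  representing them yields the same value, as the flat form descends to the quotient.
\<close>
lemma d_form_dproj:
  assumes \<theta>: "\<And>z v. z \<in> level \<Longrightarrow> v \<in> tangents z \<Longrightarrow> \<theta> (dproj K k z v) = dbar_potential z v"
    and z: "z \<in> level" and v: "v \<in> tangents z" and w: "w \<in> tangents z"
  shows "d_form level K k \<theta> (dproj K k z v) (dproj K k z w) = - \<i> * flat_form v w"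
  unfolding d_form_def
proof (rule the_equality)
  define D where "D h = fst h *\<^sub>R v + snd h *\<^sub>R w" for h :: "real \<times> real"
  have "linear D" by (auto intro!: linearI simp: D_def algebra_simps)
  moreover have "D h \<in> tangents z" for h
    unfolding D_def using v w subspace_tangents by (intro subspace_add subspace_scale)
  ultimately obtain U s where s: "smooth_plot level U s" "s 0 = z" "(s has_derivative D) (at 0)"
    by (rule plot_with_derivative[OF z])
  have fd: "frechet_derivative s (at 0) = D" using frechet_derivative_at[OF s(3)] by simp
  obtain r1 r2 where r: "((\<lambda>x. \<theta> (pushforward K k s (x, 0) (0, 1))) has_vector_derivative r1) (at 0)"
    "((\<lambda>y. \<theta> (pushforward K k s (0, y) (1, 0))) has_vector_derivative r2) (at 0)"
    "r1 - r2 = - \<i> * flat_form v w"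
    using plot_curl[OF \<theta> s(1)] by (auto simp: fd D_def)
  moreover have "pushforward K k s 0 (1, 0) = dproj K k z v" "pushforward K k s 0 (0, 1) = dproj K k z w"
    by (simp_all add: pushforward_def fd s(2) D_def)
  ultimately show "\<exists>U s r1 r2. smooth_plot level U s \<and>
     dproj K k z v = pushforward K k s 0 (1, 0) \<and> dproj K k z w = pushforward K k s 0 (0, 1) \<and>
     ((\<lambda>x. \<theta> (pushforward K k s (x, 0) (0, 1))) has_vector_derivative r1) (at (0::real)) \<and>
     ((\<lambda>y. \<theta> (pushforward K k s (0, y) (1, 0))) has_vector_derivative r2) (at (0::real)) \<and>
     - \<i> * flat_form v w = r1 - r2"
    using s(1) by metis
next
  fix r assume "\<exists>U s r1 r2. smooth_plot level U s \<and>
     dproj K k z v = pushforward K k s 0 (1, 0) \<and> dproj K k z w = pushforward K k s 0 (0, 1) \<and>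
     ((\<lambda>x. \<theta> (pushforward K k s (x, 0) (0, 1))) has_vector_derivative r1) (at (0::real)) \<and>
     ((\<lambda>y. \<theta> (pushforward K k s (0, y) (1, 0))) has_vector_derivative r2) (at (0::real)) \<and> r = r1 - r2"
  then obtain U s r1 r2 where s: "smooth_plot level U s"
    and vw: "dproj K k z v = dproj K k (s 0) (frechet_derivative s (at 0) (1, 0))"
      "dproj K k z w = dproj K k (s 0) (frechet_derivative s (at 0) (0, 1))"
    and r: "((\<lambda>x. \<theta> (pushforward K k s (x, 0) (0, 1))) has_vector_derivative r1) (at (0::real))"
     "((\<lambda>y. \<theta> (pushforward K k s (0, y) (1, 0))) has_vector_derivative r2) (at (0::real))" "r = r1 - r2"
    unfolding pushforward_def[of K k _ 0] by blast
  obtain r1' r2' where r': "((\<lambda>x. \<theta> (pushforward K k s (x, 0) (0, 1))) has_vector_derivative r1') (at 0)"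
    "((\<lambda>y. \<theta> (pushforward K k s (0, y) (1, 0))) has_vector_derivative r2') (at 0)"
    "r1' - r2' = - \<i> * flat_form (frechet_derivative s (at 0) (1, 0)) (frechet_derivative s (at 0) (0, 1))"
    using plot_curl[OF \<theta> s] by blast
  have "r1 = r1'" "r2 = r2'"
    using r r' vector_derivative_unique_at by blast+
  then show "r = - \<i> * flat_form v w"
    using r(3) r'(3) flat_form_representatives[OF vw z v w] by simp
qed

text \<open>
  On horizontal representatives the complex structure preserves the flat form, so taking the
  (1,1)-part changes nothing.
\<close>
theorem reduced_form_eq_del_dbar:
  assumes f: "\<And>z. z \<in> level \<Longrightarrow> f (proj K z) = potential z + C"
    and X: "X \<in> q_tangent_space level K k p" and Y: "Y \<in> q_tangent_space level K k p"
  shows "reduced_form level K k X Y =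
    \<i> * del_form level K k (dbar_fun level K k (\<lambda>p. complex_of_real (f p))) X Y"
proof -
  obtain z v w where z: "z \<in> level" and v: "v \<in> tangents z" and w: "w \<in> tangents z"
    and XY: "X = dproj K k z v" "Y = dproj K k z w"
    using q_tangent_space_pair[OF X Y] .
  obtain h1 w1 where h1: "h1 \<in> horizontal level k z" "w1 \<in> vert k z" "v = h1 + w1"
    using horizontal_decomposition[OF z v] .
  obtain h2 w2 where h2: "h2 \<in> horizontal level k z" "w2 \<in> vert k z" "w = h2 + w2"
    using horizontal_decomposition[OF z w] .
  have XY': "X = dproj K k z h1" "Y = dproj K k z h2"
    by (simp_all add: XY h1(3) h2(3) dproj_vert h1(2) h2(2))
  have tan: "h1 \<in> tangents z" "(\<chi> j. \<i> * h1 $ j) \<in> tangents z" "h2 \<in> tangents z" "(\<chi> j. \<i> * h2 $ j) \<in> tangents z"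
    using h1(1) h2(1) by (simp_all add: horizontal_iff[OF z])
  let ?\<theta> = "dbar_fun level K k (\<lambda>p. complex_of_real (f p))"
  have \<theta>: "?\<theta> (dproj K k z v) = dbar_potential z v" if "z \<in> level" "v \<in> tangents z" for z v
    using f by (intro dbar_fun_dproj[OF _ that]) simp
  have J: "flat_form (\<chi> j. \<i> * h1 $ j) (\<chi> j. \<i> * h2 $ j) = flat_form h1 h2"
    by (simp add: flat_form_def algebra_simps)
  have "d_form level K k ?\<theta> X Y = - \<i> * flat_form h1 h2"
    unfolding XY' by (rule d_form_dproj[OF \<theta> z tan(1,3)])
  moreover have "d_form level K k ?\<theta> (reduced_J level K k X) (reduced_J level K k Y) = - \<i> * flat_form h1 h2"
    unfolding XY' reduced_J_dproj[OF z h1(1)] reduced_J_dproj[OF z h2(1)]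
    using d_form_dproj[OF \<theta> z tan(2,4)] by (simp only: J)
  ultimately show ?thesis
    unfolding del_form_def by (simp add: XY' reduced_form_dproj[OF z tan(1,3)])
qed

end

section \<open>The toric quotient\<close>

lemma dual_basis_apply: "dual_basis j t = t $ j"
  unfolding dual_basis_def by (rule bounded_linear_Blinfun_apply[OF bounded_linear_vec_nth, THEN fun_cong])

lemma A_map_apply:
  fixes u :: "'n::finite \<Rightarrow> 'g::euclidean_space"
  shows "A_map u t = (\<Sum>j\<in>UNIV. t $ j *\<^sub>R u j)"
proof -
  have "linear (\<lambda>t::real^'n. \<Sum>j\<in>UNIV. t $ j *\<^sub>R u j)"
    by (auto intro!: linearI simp: algebra_simps sum.distrib scaleR_sum_right)
  then have "bounded_linear (\<lambda>t::real^'n. \<Sum>j\<in>UNIV. t $ j *\<^sub>R u j)"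
    by (simp add: linear_conv_bounded_linear)
  then show ?thesis unfolding A_map_def by (simp add: bounded_linear_Blinfun_apply)
qed

lemma blinfun_A_map:
  fixes u :: "'n::finite \<Rightarrow> 'g::euclidean_space" and \<eta> :: "'g \<Rightarrow>\<^sub>L real"
  shows "\<eta> (A_map u t) = (\<Sum>j\<in>UNIV. t $ j * \<eta> (u j))"
  by (simp add: A_map_apply blinfun.sum_right blinfun.scaleR_right)

lemma A_map_axis:
  fixes u :: "'n::finite \<Rightarrow> 'g::euclidean_space"
  shows "A_map u (axis j 1) = u j"
  by (simp add: A_map_apply axis_def if_distrib[of "\<lambda>r. r *\<^sub>R _"] cong: if_cong)

lemma phi_apply: "phi z t = (\<Sum>j\<in>UNIV. t $ j * (cmod (z $ j))\<^sup>2)"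
  by (simp add: phi_def blinfun.sum_left blinfun.scaleR_left dual_basis_apply mult.commute)

lemma lam_vec_apply: "lam_vec lam t = (\<Sum>j\<in>UNIV. t $ j * lam j)"
  by (simp add: lam_vec_def blinfun.sum_left blinfun.scaleR_left dual_basis_apply mult.commute)

lemma iota_apply: "iota u lam \<eta> t = \<eta> (A_map u t) - lam_vec lam t"
  by (simp add: iota_def A_dual_def blinfun.add_left blinfun.minus_left blinfun.diff_left)

lemma level_set_iff:
  "z \<in> level_set u lam \<longleftrightarrow> (\<forall>t\<in>k_alg u. (\<Sum>j\<in>UNIV. t $ j * ((cmod (z $ j))\<^sup>2 + lam j)) = 0)"
proof -
  have "z \<in> level_set u lam \<longleftrightarrow> (\<forall>t\<in>k_alg u. phi z t = - lam_vec lam t)"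
    by (auto simp: level_set_def phi_K_def nu_def B_dual_def restrict_def fun_eq_iff blinfun.minus_left)
  then show ?thesis
    by (simp add: phi_apply lam_vec_apply eq_neg_iff_add_eq_0 algebra_simps sum.distrib)
qed

lemma surj_A_map:
  fixes u :: "'n::finite \<Rightarrow> 'g::euclidean_space"
  assumes "span (range u) = UNIV"
  shows "surj (A_map u)"
proof -
  have "subspace (range (A_map u))"
    by (intro linear_subspace_image subspace_UNIV bounded_linear.linear blinfun.bounded_linear_right)
  moreover have "range u \<subseteq> range (A_map u)"
    using A_map_axis[of u] by (metis image_subsetI rangeI)
  ultimately show ?thesis using assms span_minimal by blast
qed

lemma inj_iota:
  fixes u :: "'n::finite \<Rightarrow> 'g::euclidean_space"
  assumes "span (range u) = UNIV"
  shows "inj (iota u lam)"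
proof (rule injI, rule blinfun_eqI)
  fix \<eta> \<eta>' :: "'g \<Rightarrow>\<^sub>L real" and v
  assume "iota u lam \<eta> = iota u lam \<eta>'"
  then have "\<eta> (A_map u t) = \<eta>' (A_map u t)" for t
    using iota_apply[of u lam \<eta> t] iota_apply[of u lam \<eta>' t] by simp
  then show "\<eta> v = \<eta>' v" using surj_A_map[OF assms] by (metis surjD)
qed

text \<open>
  On the level set \<open>phi z + lam_vec lam\<close> vanishes on the kernel of the surjective map \<open>A_map u\<close>, so it
  factors through \<open>A_map u\<close>; the factor is obtained from a linear right inverse.
\<close>
lemma level_set_phi_iota:
  fixes u :: "'n::finite \<Rightarrow> 'g::euclidean_space"
  assumes span: "span (range u) = UNIV" and z: "z \<in> level_set u lam"
  obtains \<eta> where "phi z = iota u lam \<eta>"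
proof -
  have lin: "linear (A_map u)" by (intro bounded_linear.linear blinfun.bounded_linear_right)
  obtain g where g: "linear g" "A_map u \<circ> g = id"
    using linear_surjective_right_inverse[OF lin surj_A_map[OF span]] by blast
  have Ag: "A_map u (g x) = x" for x using g(2) by (simp add: fun_eq_iff)
  have bg: "bounded_linear g" using g(1) by (simp add: linear_conv_bounded_linear)
  define \<eta> where "\<eta> = (phi z + lam_vec lam) o\<^sub>L Blinfun g"
  have vanish: "(phi z + lam_vec lam) s = 0" if "s \<in> k_alg u" for s
    using z that
    by (simp add: level_set_iff blinfun.add_left phi_apply lam_vec_apply algebra_simps sum.distrib)
  have "phi z t = iota u lam \<eta> t" for t
  proof -
    have "t - g (A_map u t) \<in> k_alg u" by (simp add: k_alg_def blinfun.diff_right Ag)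
    from vanish[OF this] show ?thesis
      by (simp add: iota_apply \<eta>_def bounded_linear_Blinfun_apply[OF bg] blinfun.diff_right blinfun.add_left)
  qed
  then show ?thesis using that blinfun_eqI by blast
qed

lemma full_lattice_closed:
  assumes "full_lattice L"
  shows "0 \<in> L" "x \<in> L \<Longrightarrow> y \<in> L \<Longrightarrow> x + y \<in> L" "x \<in> L \<Longrightarrow> - x \<in> L"
proof -
  obtain B where L: "L = range (\<lambda>c. \<Sum>b\<in>B. of_int (c b) *\<^sub>R b)"
    using assms by (auto simp: full_lattice_def)
  show "0 \<in> L" unfolding L by (rule range_eqI[of _ _ "\<lambda>_. 0"]) simp
  show "x + y \<in> L" if xy: "x \<in> L" "y \<in> L"
  proof -
    obtain c d where "x = (\<Sum>b\<in>B. of_int (c b) *\<^sub>R b)" "y = (\<Sum>b\<in>B. of_int (d b) *\<^sub>R b)"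
      using xy unfolding L by blast
    then show ?thesis unfolding L
      by (intro range_eqI[of _ _ "\<lambda>b. c b + d b"]) (simp add: scaleR_left_distrib sum.distrib)
  qed
  show "- x \<in> L" if x: "x \<in> L"
  proof -
    obtain c where "x = (\<Sum>b\<in>B. of_int (c b) *\<^sub>R b)" using x unfolding L by blast
    then show ?thesis unfolding L
      by (intro range_eqI[of _ _ "\<lambda>b. - c b"]) (simp add: sum_negf)
  qed
qed

lemma torus_exp_add: "torus_exp (s + t) = torus_exp s * torus_exp t"
  by (simp add: torus_exp_def vec_eq_iff algebra_simps exp_add)

lemma torus_exp_0: "torus_exp 0 = 1"
  by (simp add: torus_exp_def vec_eq_iff)

lemma stratum_reduction_K_group:
  fixes ZG :: "'g::euclidean_space set" and u :: "'n::finite \<Rightarrow> 'g"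
  assumes ZG: "full_lattice ZG" and c: "\<And>j. j \<in> I \<Longrightarrow> c j = 0"
  shows "stratum_reduction (K_group ZG u) (k_alg u) c I"
proof
  note cl = full_lattice_closed[OF ZG]
  show "1 \<in> K_group ZG u"
    unfolding K_group_def torus_exp_0[symmetric] using cl(1) by (auto simp: blinfun.zero_right)
  show "a * b \<in> K_group ZG u" if ab: "a \<in> K_group ZG u" "b \<in> K_group ZG u" for a b
  proof -
    obtain s t where "A_map u s \<in> ZG" "A_map u t \<in> ZG" "a = torus_exp s" "b = torus_exp t"
      using ab by (auto simp: K_group_def)
    then show ?thesis unfolding K_group_def
      by (intro image_eqI[of _ _ "s + t"]) (simp_all add: torus_exp_add blinfun.add_right cl(2))
  qed
  show "\<exists>b\<in>K_group ZG u. b * a = 1" if a: "a \<in> K_group ZG u" for a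
  proof -
    obtain s where s: "A_map u s \<in> ZG" "a = torus_exp s" using a by (auto simp: K_group_def)
    have "torus_exp (- s) \<in> K_group ZG u"
      using s(1) by (auto simp: K_group_def blinfun.minus_right cl(3))
    moreover have "torus_exp (- s) * a = 1"
      by (simp add: s(2) torus_exp_0 flip: torus_exp_add)
    ultimately show ?thesis by blast
  qed
  show "cmod (a $ j) = 1" if "a \<in> K_group ZG u" for a j
    using that by (auto simp: K_group_def torus_exp_def norm_exp_eq_Re)
  show "subspace (k_alg u)"
    by (simp add: subspace_def k_alg_def blinfun.zero_right blinfun.add_right blinfun.scaleR_right)
qed (rule c)

lemma phi_P_proj:
  fixes ZG :: "'g::euclidean_space set" and u :: "'n::finite \<Rightarrow> 'g"
  assumes ZG: "full_lattice ZG" and span: "span (range u) = UNIV"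
    and z: "z \<in> level_set u lam"
  shows "phi_P u lam (proj (K_group ZG u) z) (u j) = (cmod (z $ j))\<^sup>2 + lam j"
proof -
  \<comment> \<open>the interpretation provides the group laws of \<open>K_group ZG u\<close>, which do not involve \<open>c\<close> and \<open>I\<close>\<close>
  interpret stratum_reduction "K_group ZG u" "k_alg u" "\<lambda>_. 0" UNIV
    by (rule stratum_reduction_K_group[OF ZG]) simp
  obtain \<eta> where \<eta>: "phi z = iota u lam \<eta>" using level_set_phi_iota[OF span z] .
  have "phi (a * z) = phi z" if "a \<in> K_group ZG u" for a
    by (simp add: phi_def norm_mult unit_K[OF that])
  then have "phi ` proj (K_group ZG u) z = {phi z}"
    using one_K by (auto simp: proj_def image_image)
  then have "phi_P u lam (proj (K_group ZG u) z) = \<eta>"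
    by (simp add: phi_P_def phi_bar_def \<eta> inv_f_f[OF inj_iota[OF span]])
  moreover have "\<eta> (u j) = (cmod (z $ j))\<^sup>2 + lam j"
  proof -
    have "phi z (axis j 1) = iota u lam \<eta> (axis j 1)" using \<eta> by simp
    moreover have "(\<Sum>i\<in>UNIV. axis j 1 $ i * r i) = r j" for r :: "'n \<Rightarrow> real"
      by (simp add: axis_def if_distrib[of "\<lambda>x. x * _"] cong: if_cong)
    ultimately show ?thesis
      by (simp add: phi_apply iota_apply lam_vec_apply A_map_axis)
  qed
  ultimately show ?thesis by simp
qed

theorem theorem5p2:
  fixes ZG :: "'g::euclidean_space set"
    and u :: "'n::finite \<Rightarrow> 'g"
    and lam :: "'n \<Rightarrow> real"
    and I :: "'n set"
    and F :: "('g \<Rightarrow>\<^sub>L real) set"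
    and \<eta>0 :: "'g \<Rightarrow>\<^sub>L real"
  assumes "full_lattice ZG"
    and "\<forall>j. primitive_in ZG (u j)"
    and "span (range u) = UNIV"
    and "interior (polyhedron_of u lam) \<noteq> {}"
    and "\<forall>i. polyhedron_of u lam \<subset> {\<eta> :: 'g \<Rightarrow>\<^sub>L real. \<forall>j. j \<noteq> i \<longrightarrow> \<eta> (u j) - lam j \<ge> 0}"
    and "I \<noteq> {}"
    and "F face_of polyhedron_of u lam"
    and "rel_interior F = open_face u lam I"
    and "\<eta>0 \<in> open_face u lam I"
  shows "\<forall>p \<in> M_face ZG u lam I. \<forall>X \<in> T_M_face ZG u lam I p. \<forall>Y \<in> T_M_face ZG u lam I p.
    omega_face ZG u lam I X Y =
      \<i> * del_dbar_face ZG u lam I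
        ((\<lambda>\<xi> :: 'g \<Rightarrow>\<^sub>L real. \<Sum>j\<in>-I. (lam j - \<eta>0 (u j)) * ln (\<xi> (u j) + \<eta>0 (u j) - lam j) + \<xi> (u j))
          \<circ> (inv_into (annihilator u I) (gamma_map \<eta>0) \<circ> phi_P u lam)) X Y"
proof (intro ballI)
  fix p X Y
  assume X: "X \<in> T_M_face ZG u lam I p" and Y: "Y \<in> T_M_face ZG u lam I p"
  define c where "c j = lam j - \<eta>0 (u j)" for j
  have c0: "c j = 0" if "j \<in> I" for j
    using assms(9) that by (auto simp: c_def open_face_def)
  interpret stratum_reduction "K_group ZG u" "k_alg u" c I
    by (rule stratum_reduction_K_group[OF assms(1) c0])
  \<comment> \<open>replacing \<open>lam\<close> by \<open>c\<close> does not affect the level, since \<open>\<eta>0\<close> composed with \<open>A_map u\<close> vanishes on \<open>k_alg u\<close>\<close>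
  have level_eq: "level_stratum u lam I = level"
  proof -
    have "(\<Sum>j\<in>UNIV. t $ j * ((cmod (z $ j))\<^sup>2 + c j)) =
        (\<Sum>j\<in>UNIV. t $ j * ((cmod (z $ j))\<^sup>2 + lam j))" if "t \<in> k_alg u" for t z
    proof -
      have "(\<Sum>j\<in>UNIV. t $ j * \<eta>0 (u j)) = 0"
        using that blinfun_A_map[of \<eta>0 u t] by (simp add: k_alg_def blinfun.zero_right)
      then show ?thesis by (simp add: c_def algebra_simps sum.distrib sum_subtractf)
    qed
    then show ?thesis by (auto simp: level_stratum_def level_def level_set_iff)
  qed
  let ?f = "(\<lambda>\<xi> :: 'g \<Rightarrow>\<^sub>L real. \<Sum>j\<in>-I. (lam j - \<eta>0 (u j)) * ln (\<xi> (u j) + \<eta>0 (u j) - lam j) + \<xi> (u j))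
          \<circ> (inv_into (annihilator u I) (gamma_map \<eta>0) \<circ> phi_P u lam)"
  have f: "?f (proj (K_group ZG u) z) = potential z + (\<Sum>j\<in>UNIV. c j)" if z: "z \<in> level" for z
  proof -
    define \<eta> where "\<eta> = phi_P u lam (proj (K_group ZG u) z)"
    have \<eta>u: "\<eta> (u j) = (cmod (z $ j))\<^sup>2 + lam j" for j
      unfolding \<eta>_def using z by (intro phi_P_proj assms) (simp add: level_eq[symmetric] level_stratum_def)
    then have \<xi>u: "(\<eta> - \<eta>0) (u j) = (cmod (z $ j))\<^sup>2 + c j" for j
      by (simp add: blinfun.diff_left c_def)
    have "\<eta> - \<eta>0 \<in> annihilator u I"
      unfolding annihilator_def using \<xi>u c0 level_zero_iff[OF z] by simp
    moreover have "inj_on (gamma_map \<eta>0) (annihilator u I)"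
      by (auto intro!: inj_onI simp: gamma_map_def)
    ultimately have "inv_into (annihilator u I) (gamma_map \<eta>0) \<eta> = \<eta> - \<eta>0"
      by (intro inv_into_f_eq) (simp_all add: gamma_map_def)
    then have "?f (proj (K_group ZG u) z) =
        (\<Sum>j\<in>-I. c j * ln ((cmod (z $ j))\<^sup>2) + ((cmod (z $ j))\<^sup>2 + c j))"
      by (simp add: \<xi>u flip: \<eta>_def) (simp add: c_def)
    also have "\<dots> = (\<Sum>j\<in>UNIV. c j * ln ((cmod (z $ j))\<^sup>2) + ((cmod (z $ j))\<^sup>2 + c j))"
      by (rule sum.mono_neutral_left) (simp_all add: c0 level_zero_iff[OF z])
    finally show ?thesis by (simp add: potential_def sum.distrib add.assoc)
  qed
  show "omega_face ZG u lam I X Y = \<i> * del_dbar_face ZG u lam I ?f X Y"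
    unfolding omega_face_def del_dbar_face_def level_eq
    by (rule reduced_form_eq_del_dbar[where f = ?f,
          OF _ X[unfolded T_M_face_def level_eq] Y[unfolded T_M_face_def level_eq]]) (rule f)
qed

end
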